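(* Let $k\ge 2$ be an integer, let $G=\mathrm{BS}(1,k)=\langle a,b\mid b^{-1}ab=a^k\rangle$, and let $\mathsf{NF}\subseteq\{a,A,b,B\}^*$ be the set of normal form words for $G$ (where the letters $A,B$ represent $a^{-1},b^{-1}$). Then the language $$\{x\#y\#z : x,y,z\in\mathsf{NF},\ xy=_G z\}$$ over the alphabet $\{a,A,b,B,\#\}$ is an EDT0L language.
   Context: Notation: $\mathbb N_0=\{0,1,2,\dots\}$. $=_G$ denotes equality of the elements of $G$ represented by words, with $A$ representing $a^{-1}$ and $B$ representing $b^{-1}$. Normal form. Let $k\ge2$. For $i,j\in\mathbb Z$, $j\ge 0$, write $a^{i/k^j}$ for the element $b^ja^ib^{-j}$ of $G=\mathrm{BS}(1,k)$ (so $a^q$ is defined for every $q\in\mathbb Z[1/k]$); $A^q$ means $a^{-q}$. Every $g\in G$ can be written as $g=b^r\alpha^u$ with $r\in\mathbb Z$, $\alpha\in\{a,A\}$, and $$u=\frac{i_m}{k^m}+\frac{i_{m-1}}{k^{m-1}}+\cdots+\frac{i_1}{k}+s,\qquad m,s\in\mathbb N_0,\ i_j\in\{0,\dots,k-1\},$$ where either $m=0$ or $i_m\ne0$. The normal form $\mathsf{NF}(g)$ is the word $$b^{t}\,\alpha^{i_m}B\,\alpha^{i_{m-1}}B\cdots\alpha^{i_1}B\,\alpha^s,\qquad t=r+m,$$ over $\{a,A,b,B\}$, where $b^t$ means the word $B^{|t|}$ if $t<0$. Each $g$ has exactly one such word (when $u=0$ the choice of $\alpha$ is immaterial), and $\mathsf{NF}=\{\mathsf{NF}(g):g\in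 G\}$. EDT0L languages. An EDT0L system is a tuple $(\mathcal V,\mathcal U,\mathcal R,v_0)$ where $\mathcal V$ is a finite alphabet, $\mathcal U\subseteq\mathcal V$ is the set of terminals, $v_0\in\mathcal V^*$ is the start word (axiom), and $\mathcal R$ (the rational control) is a regular subset of $\mathcal T^*$ for some finite set $\mathcal T$ of free monoid endomorphisms $\mathcal V^*\to\mathcal V^*$ (called tables). Endomorphisms act on the right, so a string $\tau_1\tau_2\cdots\tau_n\in\mathcal T^*$ is applied by applying $\tau_1$ first, then $\tau_2$, and so on. The language of the system is $\{v\in\mathcal U^*: v=v_0\mathbf r\text{ for some }\mathbf r\in\mathcal R\}$. A language is EDT0L if it is the language of some EDT0L system. *)

theory Defs
  imports Complex_Main "HOL-Algebra.Group"
begin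

section \<open>The Baumslag--Solitar group \<open>BS(1,k)\<close>\<close>

datatype gen = gen_a | gen_A | gen_b | gen_B

text \<open>
  \<open>BS(1,k)\<close> is presented as a monoid: words over \<open>{a, A, b, B}\<close> modulo the congruence generated
  by the free cancellations, which make \<open>A\<close> and \<open>B\<close> the inverses of \<open>a\<close> and \<open>b\<close>, and by the
  relation \<open>B a b = a^k\<close>.
\<close>

inductive bs_eq :: "nat \<Rightarrow> gen list \<Rightarrow> gen list \<Rightarrow> bool" for k :: nat where
  bs_refl: "bs_eq k u u"
| bs_sym: "bs_eq k u v \<Longrightarrow> bs_eq k v u"
| bs_trans: "bs_eq k u v \<Longrightarrow> bs_eq k v w \<Longrightarrow> bs_eq k u w"
| bs_cong: "bs_eq k u u' \<Longrightarrow> bs_eq k v v' \<Longrightarrow> bs_eq k (u @ v) (u' @ v')"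
| bs_aA: "bs_eq k [gen_a, gen_A] []"
| bs_Aa: "bs_eq k [gen_A, gen_a] []"
| bs_bB: "bs_eq k [gen_b, gen_B] []"
| bs_Bb: "bs_eq k [gen_B, gen_b] []"
| bs_rel: "bs_eq k [gen_B, gen_a, gen_b] (replicate k gen_a)"

text \<open>The element of the group represented by a word.\<close>

definition elt :: "nat \<Rightarrow> gen list \<Rightarrow> gen list set" where
  "elt k u = {v. bs_eq k u v}"

definition BS :: "nat \<Rightarrow> gen list set monoid" where
  "BS k = \<lparr>carrier = range (elt k),
           mult = (\<lambda>X Y. \<Union>x\<in>X. \<Union>y\<in>Y. elt k (x @ y)),
           one = elt k []\<rparr>"

lemma elt_eq_iff: "elt k u = elt k v \<longleftrightarrow> bs_eq k u v"
proof
  assume "elt k u = elt k v"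
  moreover have "v \<in> elt k v" by (simp add: elt_def bs_refl)
  ultimately show "bs_eq k u v" by (auto simp: elt_def)
next
  assume "bs_eq k u v"
  then show "elt k u = elt k v" by (auto simp: elt_def intro: bs_trans bs_sym)
qed

lemma elt_in_carrier [simp]: "elt k u \<in> carrier (BS k)"
  by (simp add: BS_def)

lemma one_BS: "\<one>\<^bsub>BS k\<^esub> = elt k []"
  by (simp add: BS_def)

lemma mult_elt: "elt k u \<otimes>\<^bsub>BS k\<^esub> elt k v = elt k (u @ v)"
proof -
  have "elt k (x @ y) = elt k (u @ v)" if "x \<in> elt k u" "y \<in> elt k v" for x y
    using that unfolding elt_eq_iff by (auto simp: elt_def intro: bs_cong bs_sym)
  moreover have "u \<in> elt k u" "v \<in> elt k v" by (simp_all add: elt_def bs_refl)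
  ultimately have "(\<Union>x\<in>elt k u. \<Union>y\<in>elt k v. elt k (x @ y)) = elt k (u @ v)" by blast
  then show ?thesis by (simp add: BS_def)
qed

lemma ex_inverse_word: "\<exists>v. bs_eq k (v @ u) []"
proof (induction u)
  case Nil
  show ?case using bs_refl[of k "[]"] by (intro exI[of _ "[]"]) simp
next
  case (Cons x u)
  then obtain v where v: "bs_eq k (v @ u) []" by blast
  have "\<exists>y. bs_eq k [y, x] []"
    by (cases x) (auto intro: bs_aA bs_Aa bs_bB bs_Bb)
  then obtain y where "bs_eq k [y, x] []" by blast
  then have "bs_eq k (v @ [y, x] @ u) (v @ [] @ u)"
    by (intro bs_cong bs_refl)
  with v have "bs_eq k ((v @ [y]) @ x # u) []" by (auto intro: bs_trans)
  then show ?case by blast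
qed

lemma group_BS: "group (BS k)"
proof (rule groupI)
  fix X Y Z
  assume "X \<in> carrier (BS k)" "Y \<in> carrier (BS k)" "Z \<in> carrier (BS k)"
  then obtain u v w where "X = elt k u" "Y = elt k v" "Z = elt k w" by (auto simp: BS_def)
  then show "X \<otimes>\<^bsub>BS k\<^esub> Y \<otimes>\<^bsub>BS k\<^esub> Z = X \<otimes>\<^bsub>BS k\<^esub> (Y \<otimes>\<^bsub>BS k\<^esub> Z)"
    by (simp add: mult_elt)
next
  fix X assume "X \<in> carrier (BS k)"
  then obtain u where u: "X = elt k u" by (auto simp: BS_def)
  obtain v where "bs_eq k (v @ u) []" using ex_inverse_word by blast
  then have "elt k v \<otimes>\<^bsub>BS k\<^esub> X = \<one>\<^bsub>BS k\<^esub>"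
    by (simp add: u mult_elt one_BS elt_eq_iff)
  then show "\<exists>Y\<in>carrier (BS k). Y \<otimes>\<^bsub>BS k\<^esub> X = \<one>\<^bsub>BS k\<^esub>" by (meson elt_in_carrier)
next
  fix X Y assume "X \<in> carrier (BS k)" "Y \<in> carrier (BS k)"
  then obtain u v where "X = elt k u" "Y = elt k v" by (auto simp: BS_def)
  then show "X \<otimes>\<^bsub>BS k\<^esub> Y \<in> carrier (BS k)" by (simp add: mult_elt)
next
  show "\<one>\<^bsub>BS k\<^esub> \<in> carrier (BS k)" by (simp add: one_BS)
next
  fix X assume "X \<in> carrier (BS k)"
  then obtain u where "X = elt k u" by (auto simp: BS_def)
  then show "\<one>\<^bsub>BS k\<^esub> \<otimes>\<^bsub>BS k\<^esub> X = X" by (simp add: one_BS mult_elt)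
qed

abbreviation elt_a :: "nat \<Rightarrow> gen list set" where "elt_a k \<equiv> elt k [gen_a]"
abbreviation elt_b :: "nat \<Rightarrow> gen list set" where "elt_b k \<equiv> elt k [gen_b]"

section \<open>Normal forms\<close>

text \<open>
  \<open>a_pow k q\<close> is \<open>a^q\<close> for \<open>q \<in> \<int>[1/k]\<close>; lemma \<open>a_pow_eq\<close> below shows that it does not depend on
  how \<open>q\<close> is written as \<open>i / k^j\<close>. The value is unspecified if \<open>q \<notin> \<int>[1/k]\<close>.
\<close>

definition a_pow :: "nat \<Rightarrow> rat \<Rightarrow> gen list set" where
  "a_pow k q = (THE g. \<exists>(i::int) (j::nat). q = of_int i / of_nat k ^ j \<and>
     g = elt_b k [^]\<^bsub>BS k\<^esub> j \<otimes>\<^bsub>BS k\<^esub> elt_a k [^]\<^bsub>BS k\<^esub> i \<otimes>\<^bsub>BS k\<^esub> elt_b k [^]\<^bsub>BS k\<^esub> (- int j))"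

lemma elt_a_pow_nat: "elt_a k [^]\<^bsub>BS k\<^esub> (n::nat) = elt k (replicate n gen_a)"
proof (induction n)
  case 0
  show ?case by (simp add: one_BS)
next
  case (Suc n)
  then show ?case by (simp add: mult_elt replicate_append_same)
qed

lemma inv_elt_b: "inv\<^bsub>BS k\<^esub> elt_b k = elt k [gen_B]"
proof -
  interpret group "BS k" by (rule group_BS)
  have "elt k [gen_B] \<otimes>\<^bsub>BS k\<^esub> elt_b k = \<one>\<^bsub>BS k\<^esub>"
    by (simp add: mult_elt one_BS elt_eq_iff bs_Bb)
  then show ?thesis by (intro inv_equality) simp_all
qed

lemma BS_relation: "inv\<^bsub>BS k\<^esub> elt_b k \<otimes>\<^bsub>BS k\<^esub> elt_a k \<otimes>\<^bsub>BS k\<^esub> elt_b k = elt_a k [^]\<^bsub>BS k\<^esub> k"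
  by (simp add: inv_elt_b mult_elt elt_a_pow_nat elt_eq_iff bs_rel)

lemma (in group) conj_int_pow:
  assumes "x \<in> carrier G" "y \<in> carrier G"
  shows "inv y \<otimes> x [^] (i::int) \<otimes> y = (inv y \<otimes> x \<otimes> y) [^] i"
proof -
  have "(\<lambda>z. inv y \<otimes> z \<otimes> y) \<in> hom G G"
  proof (rule homI)
    fix u v assume "u \<in> carrier G" "v \<in> carrier G"
    then have "y \<otimes> (inv y \<otimes> (v \<otimes> y)) = v \<otimes> y"
      using assms by (simp flip: m_assoc)
    then show "inv y \<otimes> (u \<otimes> v) \<otimes> y = inv y \<otimes> u \<otimes> y \<otimes> (inv y \<otimes> v \<otimes> y)"
      using assms \<open>u \<in> carrier G\<close> \<open>v \<in> carrier G\<close> by (simp add: m_assoc)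
  qed (use assms in simp)
  from hom_int_pow[OF this assms(1) is_group is_group] show ?thesis .
qed

lemma (in group) conj_pow_shift:
  assumes xy: "x \<in> carrier G" "y \<in> carrier G" and rel: "inv y \<otimes> x \<otimes> y = x [^] (k::nat)"
  shows "y [^] (l::nat) \<otimes> x [^] (i * int k ^ l) \<otimes> inv (y [^] l) = x [^] i"
proof (induction l)
  case 0
  show ?case using xy by simp
next
  case (Suc l)
  let ?z = "x [^] (i * int k ^ l)"
  have "x [^] (i * int k ^ Suc l) = (x [^] int k) [^] (i * int k ^ l)"
    using xy by (simp add: int_pow_pow mult_ac)
  also have "\<dots> = inv y \<otimes> ?z \<otimes> y"
    using xy by (simp add: int_pow_int conj_int_pow flip: rel)
  finally have step: "x [^] (i * int k ^ Suc l) = inv y \<otimes> ?z \<otimes> y" .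
  have canc: "y \<otimes> (inv y \<otimes> w) = w" if "w \<in> carrier G" for w
    using xy that by (simp flip: m_assoc)
  have "y [^] Suc l \<otimes> x [^] (i * int k ^ Suc l) \<otimes> inv (y [^] Suc l) = y [^] l \<otimes> ?z \<otimes> inv (y [^] l)"
    unfolding step using xy by (simp add: m_assoc inv_mult_group canc)
  then show ?case by (simp add: Suc.IH)
qed

lemma a_pow_eq:
  assumes "k \<ge> 1"
  shows "a_pow k (of_int i / of_nat k ^ j) =
    elt_b k [^]\<^bsub>BS k\<^esub> j \<otimes>\<^bsub>BS k\<^esub> elt_a k [^]\<^bsub>BS k\<^esub> (i::int) \<otimes>\<^bsub>BS k\<^esub> elt_b k [^]\<^bsub>BS k\<^esub> (- int j)"
proof -
  interpret group "BS k" by (rule group_BS)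
  define conj where "conj i j =
    elt_b k [^]\<^bsub>BS k\<^esub> j \<otimes>\<^bsub>BS k\<^esub> elt_a k [^]\<^bsub>BS k\<^esub> i \<otimes>\<^bsub>BS k\<^esub> elt_b k [^]\<^bsub>BS k\<^esub> (- int j)"
    for i :: int and j :: nat
  have shift: "conj (i * int k ^ l) (j + l) = conj i j" for i j l
  proof -
    have "conj (i * int k ^ l) (j + l) = elt_b k [^]\<^bsub>BS k\<^esub> j \<otimes>\<^bsub>BS k\<^esub>
       (elt_b k [^]\<^bsub>BS k\<^esub> l \<otimes>\<^bsub>BS k\<^esub> elt_a k [^]\<^bsub>BS k\<^esub> (i * int k ^ l) \<otimes>\<^bsub>BS k\<^esub> inv\<^bsub>BS k\<^esub> (elt_b k [^]\<^bsub>BS k\<^esub> l))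
       \<otimes>\<^bsub>BS k\<^esub> inv\<^bsub>BS k\<^esub> (elt_b k [^]\<^bsub>BS k\<^esub> j)"
      unfolding conj_def int_pow_neg_int[OF elt_in_carrier]
      by (simp add: m_assoc inv_mult_group flip: nat_pow_mult)
    also have "\<dots> = conj i j"
      by (subst conj_pow_shift[OF _ _ BS_relation]) (simp_all add: conj_def int_pow_neg_int)
    finally show ?thesis .
  qed
  have "conj i' j' = conj i j"
    if "(of_int i / of_nat k ^ j :: rat) = of_int i' / of_nat k ^ j'" for i' j'
  proof -
    have "of_int (i * int k ^ j') = (of_int (i' * int k ^ j) :: rat)"
      using that assms by (simp add: field_simps)
    then have "i * int k ^ j' = i' * int k ^ j" by (simp only: of_int_eq_iff)
    with shift[of i j' j] shift[of i' j j'] show ?thesis by (simp add: add.commute)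
  qed
  then show ?thesis
    unfolding a_pow_def conj_def[symmetric] by (intro the_equality) blast+
qed

text \<open>The word \<open>b\<^sup>t\<close>, which is \<open>B\<^bsup>|t|\<^esup>\<close> for negative \<open>t\<close>.\<close>

definition b_word :: "int \<Rightarrow> gen list" where
  "b_word t = (if t \<ge> 0 then replicate (nat t) gen_b else replicate (nat (- t)) gen_B)"

text \<open>The word \<open>b\<^sup>t \<alpha>\<^bsup>i m\<^esup> B \<dots> \<alpha>\<^bsup>i 1\<^esup> B \<alpha>\<^sup>s\<close>.\<close>

definition nf_word :: "int \<Rightarrow> gen \<Rightarrow> nat \<Rightarrow> (nat \<Rightarrow> nat) \<Rightarrow> nat \<Rightarrow> gen list" where
  "nf_word t \<alpha> m i s =
     b_word t @ concat (map (\<lambda>j. replicate (i j) \<alpha> @ [gen_B]) (rev [1..<Suc m])) @ replicate s \<alpha>"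

definition is_nf :: "nat \<Rightarrow> gen list set \<Rightarrow> gen list \<Rightarrow> bool" where
  "is_nf k g w \<longleftrightarrow> (\<exists>(r::int) \<alpha> (u::rat) (m::nat) (s::nat) (i :: nat \<Rightarrow> nat).
     \<alpha> \<in> {gen_a, gen_A} \<and> (\<forall>j\<in>{1..m}. i j < k) \<and> (m = 0 \<or> i m \<noteq> 0) \<and>
     u = (\<Sum>j=1..m. of_nat (i j) / of_nat k ^ j) + of_nat s \<and>
     g = elt_b k [^]\<^bsub>BS k\<^esub> r \<otimes>\<^bsub>BS k\<^esub> a_pow k (if \<alpha> = gen_a then u else - u) \<and>
     w = nf_word (r + int m) \<alpha> m i s)"

definition NF :: "nat \<Rightarrow> gen list set" where
  "NF k = {w. \<exists>g\<in>carrier (BS k). is_nf k g w}"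

section \<open>EDT0L languages\<close>

text \<open>
  A set \<open>R\<close> of words over \<open>T\<close> is regular if a nondeterministic finite automaton accepts it, with
  states \<open>Q\<close>, initial states \<open>I\<close>, final states \<open>F\<close> and transitions \<open>\<Delta>\<close>. Taking natural numbers as
  states is no restriction because \<open>Q\<close> is finite.
\<close>

fun nfa_run :: "('q \<times> 't \<times> 'q) set \<Rightarrow> 'q \<Rightarrow> 't list \<Rightarrow> 'q \<Rightarrow> bool" where
  "nfa_run \<Delta> p [] q \<longleftrightarrow> p = q"
| "nfa_run \<Delta> p (x # w) q \<longleftrightarrow> (\<exists>p'. (p, x, p') \<in> \<Delta> \<and> nfa_run \<Delta> p' w q)"

definition regular_over :: "'t set \<Rightarrow> 't list set \<Rightarrow> bool" where
  "regular_over T R \<longleftrightarrow> (\<exists>(Q :: nat set) I F \<Delta>. finite Q \<and> I \<subseteq> Q \<and> F \<subseteq> Q \<and> \<Delta> \<subseteq> Q \<times> T \<times> Q \<and>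
     R = {w. \<exists>p\<in>I. \<exists>q\<in>F. nfa_run \<Delta> p w q})"

text \<open>Only the values of \<open>f\<close> on \<open>lists V\<close>, the free monoid \<open>V\<^sup>*\<close>, matter.\<close>

definition free_monoid_endo :: "'s set \<Rightarrow> ('s list \<Rightarrow> 's list) \<Rightarrow> bool" where
  "free_monoid_endo V f \<longleftrightarrow> f ` lists V \<subseteq> lists V \<and> f [] = [] \<and>
     (\<forall>u\<in>lists V. \<forall>v\<in>lists V. f (u @ v) = f u @ f v)"

definition EDT0L_system ::
  "'s set \<Rightarrow> 's set \<Rightarrow> ('s list \<Rightarrow> 's list) list set \<Rightarrow> 's list \<Rightarrow> bool" where
  "EDT0L_system V U R v\<^sub>0 \<longleftrightarrow> finite V \<and> U \<subseteq> V \<and> v\<^sub>0 \<in> lists V \<and>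
     (\<exists>T. finite T \<and> (\<forall>\<tau>\<in>T. free_monoid_endo V \<tau>) \<and> regular_over T R)"

text \<open>\<open>fold id [\<tau>\<^sub>1, \<dots>, \<tau>\<^sub>n] v\<^sub>0\<close> applies \<open>\<tau>\<^sub>1\<close> first.\<close>

definition EDT0L_language ::
  "'s set \<Rightarrow> ('s list \<Rightarrow> 's list) list set \<Rightarrow> 's list \<Rightarrow> 's list set" where
  "EDT0L_language U R v\<^sub>0 = {v \<in> lists U. \<exists>\<rho>\<in>R. v = fold id \<rho> v\<^sub>0}"

text \<open>
  The symbols of the system are the letters \<open>Inl x\<close> of the language and auxiliary symbols \<open>Inr n\<close>.
  As \<open>V\<close> is finite, this accommodates every alphabet that extends the letters of the language.
\<close>

definition EDT0L :: "'a list set \<Rightarrow> bool" where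
  "EDT0L L \<longleftrightarrow> (\<exists>(V :: ('a + nat) set) U R v\<^sub>0.
     EDT0L_system V U R v\<^sub>0 \<and> map Inl ` L = EDT0L_language U R v\<^sub>0)"

datatype letter = Gen gen | Hash

end

theory Submission
  imports Defs
begin

text \<open>
  A composition of endomorphisms, read from the last one to the first, is a run of a machine that
  updates finitely many registers holding words and may copy them; so EDT0L languages are the output
  sets of nondeterministic finite automata with such registers.

  Under \<open>b\<^sup>r a\<^sup>q \<mapsto> (r, q)\<close> the product is \<open>(r\<^sub>1, q\<^sub>1) (r\<^sub>2, q\<^sub>2) = (r\<^sub>1 + r\<^sub>2, q\<^sub>1 k\<^bsup>r\<^sub>2\<^esup> + q\<^sub>2)\<close>: after a shift of the
  base \<open>k\<close> expansion of \<open>q\<^sub>1\<close> by \<open>r\<^sub>2\<close> digits, it is an addition, which a finite automaton that reads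
  digits from the lowest one checks with a bounded carry. Along the way the registers collect the
  three normal forms: fractional digits are appended literally, and the integer part is unary, where
  copying produces the powers of \<open>k\<close>. The numbers \<open>r\<^sub>1\<close>, \<open>r\<^sub>2\<close> are distances between marked positions.
\<close>

section \<open>Automata with copying registers\<close>

definition subst :: "(nat \<Rightarrow> ('a + nat) list) \<Rightarrow> ('a + nat) list \<Rightarrow> ('a + nat) list" where
  "subst \<sigma> w = concat (map (case_sum (\<lambda>x. [Inl x]) \<sigma>) w)"

definition reg_eval :: "(nat \<Rightarrow> 'a list) \<Rightarrow> ('a + nat) list \<Rightarrow> 'a list" where
  "reg_eval \<rho> w = concat (map (case_sum (\<lambda>x. [x]) \<rho>) w)"

lemma reg_eval_simps [simp]:
  "reg_eval \<rho> [] = []"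
  "reg_eval \<rho> (Inl x # w) = x # reg_eval \<rho> w"
  "reg_eval \<rho> (Inr n # w) = \<rho> n @ reg_eval \<rho> w"
  "reg_eval \<rho> (u @ v) = reg_eval \<rho> u @ reg_eval \<rho> v"
  by (simp_all add: reg_eval_def)

lemma reg_eval_replicate [simp]:
  "reg_eval \<rho> (replicate m (Inl x)) = replicate m x"
  "reg_eval \<rho> (replicate m (Inr n)) = concat (replicate m (\<rho> n))"
  by (induction m) simp_all

text \<open>This exchange is why a composition of tables is a run read backwards: a table applied to
  a word becomes an update of the registers in which the word is evaluated.\<close>

lemma reg_eval_subst: "reg_eval \<rho> (subst \<sigma> w) = reg_eval (\<lambda>n. reg_eval \<rho> (\<sigma> n)) w"
  by (induction w) (auto simp: subst_def reg_eval_def split: sum.splits)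

text \<open>An initial valuation is itself a table; applied last, it eliminates all register
  symbols.\<close>

lemma subst_map_Inl: "subst (\<lambda>n. map Inl (\<rho> n)) w = map Inl (reg_eval \<rho> w)"
  by (induction w) (auto simp: subst_def reg_eval_def split: sum.splits)

lemma subst_in_lists:
  assumes "\<forall>n<N. \<sigma> n \<in> lists (range Inl \<union> Inr ` {..<N})" "w \<in> lists (range Inl \<union> Inr ` {..<N})"
  shows "subst \<sigma> w \<in> lists (range Inl \<union> Inr ` {..<N})"
  using assms(2)
proof (induction w)
  case (Cons x w)
  then have "case_sum (\<lambda>x. [Inl x]) \<sigma> x \<in> lists (range Inl \<union> Inr ` {..<N})"
  proof (cases x)
    case (Inr n)
    then have "n < N" using Cons.hyps by auto
    then show ?thesis using assms(1) Inr by (simp del: in_lists_conv_set)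
  qed simp
  then show ?case using Cons by (simp add: subst_def)
qed (simp add: subst_def)

lemma subst_endo:
  assumes "\<forall>n<N. \<sigma> n \<in> lists (range Inl \<union> Inr ` {..<N})"
  shows "free_monoid_endo (range Inl \<union> Inr ` {..<N}) (subst \<sigma>)"
  unfolding free_monoid_endo_def using subst_in_lists[OF assms]
  by (auto simp: subst_def simp del: in_lists_conv_set)

text \<open>All registers change simultaneously, from the old contents \<open>\<rho>\<close>. A
  register symbol may occur several times in \<open>\<sigma>\<close>, which provides the
  copying.\<close>

inductive reach :: "('q \<times> (nat \<Rightarrow> ('a + nat) list) \<times> 'q) set \<Rightarrow> ('q \<times> (nat \<Rightarrow> 'a list)) set \<Rightarrow>
    'q \<Rightarrow> (nat \<Rightarrow> 'a list) \<Rightarrow> bool" for \<Delta> I where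
  reach_init: "(q, \<rho>) \<in> I \<Longrightarrow> reach \<Delta> I q \<rho>"
| reach_step: "reach \<Delta> I q \<rho> \<Longrightarrow> (q, \<sigma>, q') \<in> \<Delta> \<Longrightarrow> reach \<Delta> I q' (\<lambda>n. reg_eval \<rho> (\<sigma> n))"

text \<open>
  The control word lists the register updates in reverse order, because the last table that is
  applied to the axiom is the one that acts on the contents of the registers first.
\<close>

theorem EDT0L_register_automaton:
  fixes \<Delta> :: "('q \<times> (nat \<Rightarrow> ('a + nat) list) \<times> 'q) set"
  assumes fin: "finite (UNIV :: 'a set)" "finite \<Delta>" "finite I"
    and \<Delta>: "\<And>q \<sigma> q' n. (q, \<sigma>, q') \<in> \<Delta> \<Longrightarrow> n < N \<Longrightarrow> \<sigma> n \<in> lists (range Inl \<union> Inr ` {..<N})"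
    and v: "v \<in> lists (range Inl \<union> Inr ` {..<N})"
  shows "EDT0L {reg_eval \<rho> v | q \<rho>. reach \<Delta> I q \<rho> \<and> q \<in> F}"
proof -
  define V :: "('a + nat) set" where "V = range Inl \<union> Inr ` {..<N}"
  define S where "S = fst ` \<Delta> \<union> (snd \<circ> snd) ` \<Delta> \<union> fst ` I"
  have finS: "finite S" using fin by (simp add: S_def)
  \<comment> \<open>The state type is arbitrary, while \<open>regular_over\<close> asks for natural
    numbers; only the finitely many occurring states are coded.\<close>
  then obtain f :: "'q \<Rightarrow> nat" where f: "inj_on f S"
    using finite_imp_inj_to_nat_seg by blast
  \<comment> \<open>Edges are reversed. \<open>Suc\<close> keeps 0 free for the single accepting
    state, entered only by loading an initial valuation.\<close>
  define E where "E = (\<lambda>(q, \<sigma>, q'). (Suc (f q'), subst \<sigma>, Suc (f q))) ` \<Delta> \<union>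
    (\<lambda>(q, \<rho>). (Suc (f q), subst (\<lambda>n. map Inl (\<rho> n)), 0)) ` I"
  define R where "R = {w. \<exists>p\<in>(Suc \<circ> f) ` (F \<inter> S). \<exists>q\<in>{0}. nfa_run E p w q}"
  have S: "q \<in> S" "q' \<in> S" if "(q, \<sigma>, q') \<in> \<Delta>" for q \<sigma> q'
    using that by (force simp: S_def)+
  have SI: "q \<in> S" if "(q, \<rho>) \<in> I" for q \<rho>
    using that by (force simp: S_def)
  have run_reach: "\<exists>\<rho>. reach \<Delta> I q \<rho> \<and> (\<forall>u. fold id w u = map Inl (reg_eval \<rho> u))"
    if "nfa_run E (Suc (f q)) w 0" "q \<in> S" for w q
    using that
  proof (induction w arbitrary: q)
    case (Cons \<tau> w)
    then obtain p where p: "(Suc (f q), \<tau>, p) \<in> E" "nfa_run E p w 0" by auto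
    from p(1) consider (step) q0 \<sigma> q1 where "(q0, \<sigma>, q1) \<in> \<Delta>" "f q = f q1" "\<tau> = subst \<sigma>" "p = Suc (f q0)"
      | (init) q1 \<rho> where "(q1, \<rho>) \<in> I" "f q = f q1" "\<tau> = subst (\<lambda>n. map Inl (\<rho> n))" "p = 0"
      by (auto simp: E_def)
    then show ?case
    proof cases
      case step
      then have [simp]: "q1 = q" using f Cons.prems(2) S by (auto dest: inj_onD)
      from Cons.IH[of q0] step p S obtain \<rho> where
        "reach \<Delta> I q0 \<rho>" "\<forall>u. fold id w u = map Inl (reg_eval \<rho> u)" by blast
      moreover from this have "\<forall>u. fold id (\<tau> # w) u = map Inl (reg_eval (\<lambda>n. reg_eval \<rho> (\<sigma> n)) u)"
        by (simp only: fold_simps step(3) reg_eval_subst id_apply) simp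
      moreover have "reach \<Delta> I q (\<lambda>n. reg_eval \<rho> (\<sigma> n))"
        using step(1) \<open>reach \<Delta> I q0 \<rho>\<close> by (auto intro: reach_step)
      ultimately show ?thesis by blast
    next
      case init
      then have [simp]: "q1 = q" using f Cons.prems(2) SI by (auto dest: inj_onD)
      \<comment> \<open>No edge of \<open>E\<close> leaves 0.\<close>
      have "w = []" using p(2) init(4) by (cases w) (auto simp: E_def)
      then show ?thesis using init by (auto simp: subst_map_Inl intro: reach_init)
    qed
  qed simp
  have reach_run: "q \<in> S \<and> (\<exists>w. nfa_run E (Suc (f q)) w 0 \<and> (\<forall>u. fold id w u = map Inl (reg_eval \<rho> u)))"
    if "reach \<Delta> I q \<rho>" for q \<rho>
    using that
  proof induction
    case (reach_init q \<rho>)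
    then have "(Suc (f q), subst (\<lambda>n. map Inl (\<rho> n)), 0) \<in> E" by (force simp: E_def)
    then have "nfa_run E (Suc (f q)) [subst (\<lambda>n. map Inl (\<rho> n))] 0" by simp
    moreover have "\<forall>u. fold id [subst (\<lambda>n. map Inl (\<rho> n))] u = map Inl (reg_eval \<rho> u)"
      by (simp add: subst_map_Inl)
    ultimately show ?case using SI[OF reach_init] by blast
  next
    case (reach_step q \<rho> \<sigma> q')
    then obtain w where w: "nfa_run E (Suc (f q)) w 0" "\<forall>u. fold id w u = map Inl (reg_eval \<rho> u)"
      by blast
    have "(Suc (f q'), subst \<sigma>, Suc (f q)) \<in> E" using reach_step by (force simp: E_def)
    then have "nfa_run E (Suc (f q')) (subst \<sigma> # w) 0" using w by auto
    moreover have "\<forall>u. fold id (subst \<sigma> # w) u = map Inl (reg_eval (\<lambda>n. reg_eval \<rho> (\<sigma> n)) u)"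
      using w by (simp add: reg_eval_subst)
    ultimately show ?case using S reach_step by blast
  qed
  define T where "T = (fst \<circ> snd) ` E"
  have "finite E" using fin by (simp add: E_def)
  then have finT: "finite T" by (simp add: T_def)
  have endo: "free_monoid_endo V \<tau>" if "\<tau> \<in> T" for \<tau>
  proof -
    from that consider (step) q \<sigma> q' where "(q, \<sigma>, q') \<in> \<Delta>" "\<tau> = subst \<sigma>"
      | (init) \<rho> where "\<tau> = subst (\<lambda>n. map Inl (\<rho> n :: 'a list))"
      by (auto simp: T_def E_def)
    then show ?thesis
    proof cases
      case step
      then show ?thesis unfolding V_def using \<Delta> by (blast intro: subst_endo)
    next
      case init
      then show ?thesis unfolding V_def by (auto intro!: subst_endo)
    qed
  qed
  have "regular_over T R" unfolding regular_over_def
  proof (intro exI conjI)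
    let ?Q = "insert 0 ((Suc \<circ> f) ` S)"
    show "finite ?Q" using finS by simp
    show "(Suc \<circ> f) ` (F \<inter> S) \<subseteq> ?Q" "{0} \<subseteq> ?Q" by auto
    show "E \<subseteq> ?Q \<times> T \<times> ?Q"
    proof
      fix e assume e: "e \<in> E"
      then have "fst (snd e) \<in> T" by (simp add: T_def)
      moreover have "fst e \<in> ?Q" "snd (snd e) \<in> ?Q" using e S SI by (auto simp: E_def)
      ultimately show "e \<in> ?Q \<times> T \<times> ?Q" by (cases e) auto
    qed
    show "R = {w. \<exists>p\<in>(Suc \<circ> f) ` (F \<inter> S). \<exists>q\<in>{0}. nfa_run E p w q}" by (simp add: R_def)
  qed
  then have "EDT0L_system V (range Inl) R v"
    unfolding EDT0L_system_def using fin finT endo v by (auto simp: V_def simp del: in_lists_conv_set)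
  moreover have "map Inl ` {reg_eval \<rho> v | q \<rho>. reach \<Delta> I q \<rho> \<and> q \<in> F} = EDT0L_language (range Inl) R v"
    (is "?L = ?M")
  proof
    show "?L \<subseteq> ?M"
    proof
      fix w assume "w \<in> ?L"
      then obtain q \<rho> where q: "reach \<Delta> I q \<rho>" "q \<in> F" "w = map Inl (reg_eval \<rho> v)" by auto
      with reach_run obtain c where "q \<in> S" "nfa_run E (Suc (f q)) c 0"
        "fold id c v = map Inl (reg_eval \<rho> v)" by blast
      then show "w \<in> ?M" using q by (auto simp: EDT0L_language_def R_def)
    qed
    show "?M \<subseteq> ?L"
    proof
      fix w assume "w \<in> ?M"
      then obtain c q where c: "q \<in> F \<inter> S" "nfa_run E (Suc (f q)) c 0" "w = fold id c v"
        by (auto simp: EDT0L_language_def R_def)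
      with run_reach obtain \<rho> where "reach \<Delta> I q \<rho>" "w = map Inl (reg_eval \<rho> v)" by blast
      with c show "w \<in> ?L" by blast
    qed
  qed
  ultimately show ?thesis unfolding EDT0L_def by blast
qed

section \<open>A faithful representation of the group\<close>

text \<open>The law of a semidirect product, read off from a^q b^r = b^r a^(q k^r).\<close>

definition bs_mul :: "nat \<Rightarrow> int \<times> rat \<Rightarrow> int \<times> rat \<Rightarrow> int \<times> rat" where
  "bs_mul k x y = (fst x + fst y, snd x * of_nat k powi fst y + snd y)"

fun gen_val :: "gen \<Rightarrow> int \<times> rat" where
  "gen_val gen_a = (0, 1)"
| "gen_val gen_A = (0, - 1)"
| "gen_val gen_b = (1, 0)"
| "gen_val gen_B = (- 1, 0)"

text \<open>The pair \<open>(r, q)\<close> stands for \<open>b\<^sup>r a\<^sup>q\<close>.\<close>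

definition val :: "nat \<Rightarrow> gen list \<Rightarrow> int \<times> rat" where
  "val k w = foldr (\<lambda>x. bs_mul k (gen_val x)) w (0, 0)"

lemma val_Nil [simp]: "val k [] = (0, 0)"
  and val_Cons: "val k (x # w) = bs_mul k (gen_val x) (val k w)"
  by (simp_all add: val_def)

lemma val_append:
  assumes "k \<ge> 1"
  shows "val k (u @ v) = bs_mul k (val k u) (val k v)"
  using assms by (induction u) (simp_all add: val_Cons bs_mul_def power_int_add algebra_simps)

lemma val_replicate:
  "val k (replicate n gen_a) = (0, of_nat n)"
  "val k (replicate n gen_A) = (0, - of_nat n)"
  "val k (replicate n gen_b) = (int n, 0)"
  "val k (replicate n gen_B) = (- int n, 0)"
  by (induction n) (simp_all add: val_Cons bs_mul_def)

text \<open>Only the defining relation needs a computation: both of its sides have value (0,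
  k).\<close>

lemma bs_eq_imp_val_eq:
  assumes "k \<ge> 1"
  shows "bs_eq k u v \<Longrightarrow> val k u = val k v"
proof (induction rule: bs_eq.induct)
  case bs_rel
  then show ?case using assms by (simp add: val_replicate val_Cons bs_mul_def)
qed (use assms in \<open>simp_all add: val_append val_Cons bs_mul_def\<close>)

section \<open>Bringing words into the shape b^j a^i b^(-l)\<close>

definition bs_form :: "nat \<Rightarrow> nat \<Rightarrow> int \<Rightarrow> nat \<Rightarrow> gen list set" where
  "bs_form k j i l = elt_b k [^]\<^bsub>BS k\<^esub> j \<otimes>\<^bsub>BS k\<^esub> elt_a k [^]\<^bsub>BS k\<^esub> i \<otimes>\<^bsub>BS k\<^esub> inv\<^bsub>BS k\<^esub> (elt_b k [^]\<^bsub>BS k\<^esub> l)"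

text \<open>Expands the fraction i / k^l by k^h: in the middle, b^h a^(i k^h) b^(-h) collapses to
  a^i.\<close>

lemma bs_form_shift: "bs_form k (j + h) (i * int k ^ h) (l + h) = bs_form k j i l"
proof -
  interpret group "BS k" by (rule group_BS)
  have "bs_form k (j + h) (i * int k ^ h) (l + h) = elt_b k [^]\<^bsub>BS k\<^esub> j \<otimes>\<^bsub>BS k\<^esub>
     (elt_b k [^]\<^bsub>BS k\<^esub> h \<otimes>\<^bsub>BS k\<^esub> elt_a k [^]\<^bsub>BS k\<^esub> (i * int k ^ h) \<otimes>\<^bsub>BS k\<^esub> inv\<^bsub>BS k\<^esub> (elt_b k [^]\<^bsub>BS k\<^esub> h))
     \<otimes>\<^bsub>BS k\<^esub> inv\<^bsub>BS k\<^esub> (elt_b k [^]\<^bsub>BS k\<^esub> l)"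
    unfolding bs_form_def by (simp add: m_assoc inv_mult_group flip: nat_pow_mult)
  also have "\<dots> = bs_form k j i l"
    by (subst conj_pow_shift[OF _ _ BS_relation]) (simp_all add: bs_form_def)
  finally show ?thesis .
qed

text \<open>Moves a^e past b^j, which multiplies its exponent by k^j.\<close>

lemma a_times_bs_form:
  "elt_a k [^]\<^bsub>BS k\<^esub> (e::int) \<otimes>\<^bsub>BS k\<^esub> bs_form k j i l = bs_form k j (e * int k ^ j + i) l"
proof -
  interpret group "BS k" by (rule group_BS)
  have "elt_a k [^]\<^bsub>BS k\<^esub> e = elt_b k [^]\<^bsub>BS k\<^esub> j \<otimes>\<^bsub>BS k\<^esub> elt_a k [^]\<^bsub>BS k\<^esub> (e * int k ^ j)
      \<otimes>\<^bsub>BS k\<^esub> inv\<^bsub>BS k\<^esub> (elt_b k [^]\<^bsub>BS k\<^esub> j)"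
    by (rule conj_pow_shift[OF _ _ BS_relation, symmetric]) simp_all
  moreover have "inv\<^bsub>BS k\<^esub> (elt_b k [^]\<^bsub>BS k\<^esub> j) \<otimes>\<^bsub>BS k\<^esub> (elt_b k [^]\<^bsub>BS k\<^esub> j \<otimes>\<^bsub>BS k\<^esub> w) = w"
    if "w \<in> carrier (BS k)" for w
    using that by (simp flip: m_assoc)
  ultimately show ?thesis
    unfolding bs_form_def by (simp add: m_assoc int_pow_mult)
qed

lemma b_times_bs_form: "elt_b k \<otimes>\<^bsub>BS k\<^esub> bs_form k j i l = bs_form k (Suc j) i l"
proof -
  interpret group "BS k" by (rule group_BS)
  have "elt_b k [^]\<^bsub>BS k\<^esub> Suc j = elt_b k \<otimes>\<^bsub>BS k\<^esub> elt_b k [^]\<^bsub>BS k\<^esub> j"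
    by (rule nat_pow_Suc2) simp
  then show ?thesis
    unfolding bs_form_def by (simp add: m_assoc del: nat_pow_Suc)
qed

lemma B_times_bs_form: "elt k [gen_B] \<otimes>\<^bsub>BS k\<^esub> bs_form k (Suc j) i l = bs_form k j i l"
proof -
  interpret group "BS k" by (rule group_BS)
  have "bs_form k j i l \<in> carrier (BS k)" by (simp add: bs_form_def)
  then have "inv\<^bsub>BS k\<^esub> elt_b k \<otimes>\<^bsub>BS k\<^esub> (elt_b k \<otimes>\<^bsub>BS k\<^esub> bs_form k j i l) = bs_form k j i l"
    by (simp flip: m_assoc)
  then show ?thesis by (simp only: b_times_bs_form inv_elt_b)
qed

text \<open>Left multiplication by a generator preserves the shape b^j a^i b^(-l), and the value
  changes accordingly.\<close>

lemma elt_eq_bs_form: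
  assumes k: "k \<ge> 1"
  shows "\<exists>j i l. elt k w = bs_form k j i l \<and> val k w = (int j - int l, of_int i / of_nat k ^ l)"
proof (induction w)
  case Nil
  interpret group "BS k" by (rule group_BS)
  have "elt k [] = bs_form k 0 0 0" unfolding one_BS[symmetric] by (simp add: bs_form_def)
  then show ?case by (intro exI[of _ 0] exI[of _ "0::int"]) simp
next
  case (Cons x w)
  interpret group "BS k" by (rule group_BS)
  obtain j i l where w: "elt k w = bs_form k j i l" "val k w = (int j - int l, of_int i / of_nat k ^ l)"
    using Cons by blast
  have k0: "(of_nat k :: rat) \<noteq> 0" using k by simp
  have pw: "(of_nat k :: rat) powi (int j - int l) = of_nat k ^ j / of_nat k ^ l"
    using k0 by (simp add: power_int_diff)
  have xw: "elt k (x # w) = elt k [x] \<otimes>\<^bsub>BS k\<^esub> bs_form k j i l"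
    by (simp add: mult_elt flip: w(1))
  have inv_a: "elt k [gen_A] = elt_a k [^]\<^bsub>BS k\<^esub> (- 1 :: int)"
  proof -
    have "elt k [gen_A] \<otimes>\<^bsub>BS k\<^esub> elt_a k = \<one>\<^bsub>BS k\<^esub>"
      by (simp add: mult_elt one_BS elt_eq_iff bs_Aa)
    then have "inv\<^bsub>BS k\<^esub> elt_a k = elt k [gen_A]" by (intro inv_equality) simp_all
    then show ?thesis by (simp add: int_pow_neg)
  qed
  show ?case
  proof (cases x)
    case gen_a
    have "elt k (x # w) = bs_form k j (int k ^ j + i) l"
      using a_times_bs_form[of k 1 j i l] xw gen_a by simp
    moreover have "val k (x # w) = (int j - int l, of_int (int k ^ j + i) / of_nat k ^ l)"
      using w pw by (simp add: gen_a val_Cons bs_mul_def add_divide_distrib)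
    ultimately show ?thesis by blast
  next
    case gen_A
    have "elt k (x # w) = bs_form k j (- (int k ^ j) + i) l"
      using a_times_bs_form[of k "-1" j i l] xw gen_A by (simp add: inv_a)
    moreover have "val k (x # w) = (int j - int l, of_int (- (int k ^ j) + i) / of_nat k ^ l)"
      using w pw by (simp add: gen_A val_Cons bs_mul_def add_divide_distrib diff_divide_distrib)
    ultimately show ?thesis by blast
  next
    case gen_b
    have "elt k (x # w) = bs_form k (Suc j) i l"
      using b_times_bs_form[of k j i l] xw gen_b by simp
    moreover have "val k (x # w) = (int (Suc j) - int l, of_int i / of_nat k ^ l)"
      using w by (simp add: gen_b val_Cons bs_mul_def)
    ultimately show ?thesis by blast
  next
    case gen_B
    show ?thesis
    proof (cases j)
      case 0
      \<comment> \<open>There is no leading b for B to cancel, so the fraction is first expanded by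
        k.\<close>
      have "bs_form k j i l = bs_form k (Suc 0) (i * int k) (Suc l)"
        using bs_form_shift[of k 0 1 i l] 0 by simp
      then have "elt k (x # w) = bs_form k 0 (i * int k) (Suc l)"
        using B_times_bs_form[of k 0] xw gen_B by simp
      moreover have "val k (x # w) = (int 0 - int (Suc l), of_int (i * int k) / of_nat k ^ Suc l)"
        using w 0 k0 by (simp add: gen_B val_Cons bs_mul_def)
      ultimately show ?thesis by blast
    next
      case (Suc j')
      then have "elt k (x # w) = bs_form k j' i l"
        using B_times_bs_form[of k j'] xw gen_B by simp
      moreover have "val k (x # w) = (int j' - int l, of_int i / of_nat k ^ l)"
        using w Suc by (simp add: gen_B val_Cons bs_mul_def)
      ultimately show ?thesis by blast
    qed
  qed
qed

text \<open>Injectivity: two forms with equal values become identical after each is expanded by the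
  denominator of the other.\<close>

theorem elt_eq_iff_val_eq:
  assumes k: "k \<ge> 1"
  shows "elt k u = elt k v \<longleftrightarrow> val k u = val k v"
proof
  assume "elt k u = elt k v"
  then show "val k u = val k v" using bs_eq_imp_val_eq[OF k] by (simp add: elt_eq_iff)
next
  assume eq: "val k u = val k v"
  obtain j i l where u: "elt k u = bs_form k j i l" "val k u = (int j - int l, of_int i / of_nat k ^ l)"
    using elt_eq_bs_form[OF k] by blast
  obtain j' i' l' where v: "elt k v = bs_form k j' i' l'" "val k v = (int j' - int l', of_int i' / of_nat k ^ l')"
    using elt_eq_bs_form[OF k] by blast
  have jl: "j + l' = j' + l" using eq u v by auto
  have "of_int (i * int k ^ l') = (of_int (i' * int k ^ l) :: rat)"
    using eq u v k by (simp add: field_simps)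
  then have il: "i * int k ^ l' = i' * int k ^ l" by (simp only: of_int_eq_iff)
  show "elt k u = elt k v"
    using bs_form_shift[of k j l' i l] bs_form_shift[of k j' l i' l'] jl il u v
    by (simp add: add.commute)
qed

section \<open>Normal forms read off a tape of digits\<close>

text \<open>Positions count digits from the lowest: \<open>p\<close> is the first one in use,
  \<open>c\<close> the radix point, and the initial power of b has exponent r - p, one letter per
  position between the two. The word grows at both ends, b-letters in front and digits behind, to
  suit a one-way reader.\<close>

primrec tape_word :: "nat \<Rightarrow> gen \<Rightarrow> nat \<Rightarrow> nat \<Rightarrow> nat \<Rightarrow> (nat \<Rightarrow> nat) \<Rightarrow> nat \<Rightarrow> gen list" where
  "tape_word k \<alpha> p c r d 0 = []"
| "tape_word k \<alpha> p c r d (Suc n) =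
     (if p \<le> n \<and> n < r then [gen_b] else if r \<le> n \<and> n < p then [gen_B] else []) @
     tape_word k \<alpha> p c r d n @
     (if c \<le> n then replicate (d n * k ^ (n - c)) \<alpha>
      else if p \<le> n then replicate (d n) \<alpha> @ [gen_B] else [])"

text \<open>A mark at or beyond \<open>n\<close> has not yet influenced the word and may still be
  moved; this lets the automaton guess marks only when it meets them.\<close>

lemma tape_word_cong:
  assumes "p = p' \<or> n \<le> p \<and> n \<le> p'" "c = c' \<or> n \<le> c \<and> n \<le> c'" "r = r' \<or> n \<le> r \<and> n \<le> r'"
    and "\<And>j. j < n \<Longrightarrow> d j = d' j"
  shows "tape_word k \<alpha> p c r d n = tape_word k \<alpha> p' c' r' d' n"
  using assms
proof (induction n)
  case (Suc n)
  then have "tape_word k \<alpha> p c r d n = tape_word k \<alpha> p' c' r' d' n" by auto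
  moreover have "p \<le> n \<longleftrightarrow> p' \<le> n" "r \<le> n \<longleftrightarrow> r' \<le> n" "c \<le> n \<longleftrightarrow> c' \<le> n" "c \<le> n \<Longrightarrow> c = c'" "d n = d' n"
    "n < p \<longleftrightarrow> n < p'" "n < r \<longleftrightarrow> n < r'"
    using Suc.prems by auto
  ultimately show ?case by auto
qed simp

lemma Cons_b_word:
  "t \<ge> 0 \<Longrightarrow> gen_b # b_word t = b_word (t + 1)"
  "t \<le> 0 \<Longrightarrow> gen_B # b_word t = b_word (t - 1)"
proof -
  assume "t \<ge> 0"
  then have "nat (t + 1) = Suc (nat t)" by simp
  with \<open>t \<ge> 0\<close> show "gen_b # b_word t = b_word (t + 1)" by (simp add: b_word_def)
next
  assume "t \<le> 0"
  then have "nat (1 - t) = Suc (nat (- t))" by simp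
  with \<open>t \<le> 0\<close> show "gen_B # b_word t = b_word (t - 1)" by (auto simp: b_word_def)
qed

lemma tape_word_closed_form:
  assumes "p \<le> c"
  shows "tape_word k \<alpha> p c r d n = b_word (int (min r n) - int (min p n)) @
    concat (map (\<lambda>j. replicate (d j) \<alpha> @ [gen_B]) [p..<min c n]) @
    replicate (\<Sum>j=c..<n. d j * k ^ (j - c)) \<alpha>"
proof (induction n)
  case 0
  show ?case by (simp add: b_word_def)
next
  case (Suc n)
  let ?B = "b_word (int (min r n) - int (min p n))"
  have b: "(if p \<le> n \<and> n < r then [gen_b] else if r \<le> n \<and> n < p then [gen_B] else []) @ ?B
      = b_word (int (min r (Suc n)) - int (min p (Suc n)))" (is "_ = ?B'")
  proof -
    consider "p \<le> n" "n < r" | "r \<le> n" "n < p" | "p \<le> n" "r \<le> n" | "n < p" "n < r" by linarith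
    then show ?thesis
    proof cases
      case 1
      then show ?thesis by (simp add: Cons_b_word algebra_simps)
    next
      case 2
      then have "gen_B # b_word (int r - int n) = b_word (int r - int n - 1)"
        by (simp add: Cons_b_word)
      then show ?thesis using 2 by (simp add: algebra_simps)
    qed (simp_all)
  qed
  have s: "concat (map (\<lambda>j. replicate (d j) \<alpha> @ [gen_B]) [p..<min c n]) @
      replicate (\<Sum>j=c..<n. d j * k ^ (j - c)) \<alpha> @
      (if c \<le> n then replicate (d n * k ^ (n - c)) \<alpha>
       else if p \<le> n then replicate (d n) \<alpha> @ [gen_B] else []) =
    concat (map (\<lambda>j. replicate (d j) \<alpha> @ [gen_B]) [p..<min c (Suc n)]) @
      replicate (\<Sum>j=c..<Suc n. d j * k ^ (j - c)) \<alpha>"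
  proof (cases "c \<le> n")
    case True
    then show ?thesis by (simp flip: replicate_add)
  next
    case False
    then have "min c n = n" "min c (Suc n) = Suc n" by auto
    with False assms show ?thesis by simp
  qed
  show ?case unfolding tape_word.simps Suc.IH b[symmetric] by (simp add: s)
qed

section \<open>Values of normal forms and of tapes\<close>

lemma val_nf_word:
  assumes k: "k \<ge> 1" and \<alpha>: "\<alpha> \<in> {gen_a, gen_A}"
  shows "val k (nf_word t \<alpha> m i s) = (t - int m,
    (if \<alpha> = gen_a then 1 else - 1) * ((\<Sum>j=1..m. of_nat (i j) / of_nat k ^ j) + of_nat s))"
proof -
  have k0: "(of_nat k :: rat) \<noteq> 0" using k by simp
  define e :: rat where "e = (if \<alpha> = gen_a then 1 else - 1)"
  have rep: "val k (replicate n \<alpha>) = (0, e * of_nat n)" for n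
    using \<alpha> by (auto simp: e_def val_replicate)
  have body: "val k (concat (map (\<lambda>j. replicate (i j) \<alpha> @ [gen_B]) (rev [1..<Suc m])) @ replicate s \<alpha>) =
    (- int m, e * ((\<Sum>j=1..m. of_nat (i j) / of_nat k ^ j) + of_nat s))"
  proof (induction m)
    case 0
    show ?case by (simp add: rep)
  next
    case (Suc m)
    let ?w = "\<lambda>m. concat (map (\<lambda>j. replicate (i j) \<alpha> @ [gen_B]) (rev [1..<Suc m])) @ replicate s \<alpha>"
    \<comment> \<open>The highest index comes first, so a new digit is prepended; the
      \<open>m\<close> letters B after its own divide it further by k^m.\<close>
    have split: "?w (Suc m) = (replicate (i (Suc m)) \<alpha> @ [gen_B]) @ ?w m" by simp
    have head: "val k (replicate (i (Suc m)) \<alpha> @ [gen_B]) = (- 1, e * of_nat (i (Suc m)) / of_nat k)"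
      by (simp add: val_append[OF k] rep val_Cons bs_mul_def power_int_minus field_simps)
    have pw: "(of_nat k :: rat) powi (- int m) = 1 / of_nat k ^ m"
      by (simp add: power_int_minus field_simps)
    show ?case
      unfolding split val_append[OF k, of "replicate (i (Suc m)) \<alpha> @ [gen_B]"] head Suc.IH bs_mul_def
        fst_conv snd_conv pw
      by (simp add: distrib_left)
  qed
  have "val k (b_word t) = (t, 0)" by (simp add: b_word_def val_replicate)
  then show ?thesis
    unfolding nf_word_def val_append[OF k, of "b_word t"] body by (simp add: bs_mul_def e_def)
qed

text \<open>The group element in \<open>is_nf\<close> disappears once it is known to lie in the
  carrier. As \<open>a_pow\<close> is a definite description, this requires writing its exponent as
  an integer over k^m.\<close>

lemma NF_iff:
  assumes k: "k \<ge> 1"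
  shows "w \<in> NF k \<longleftrightarrow> (\<exists>r \<alpha> m s i. \<alpha> \<in> {gen_a, gen_A} \<and> (\<forall>j\<in>{1..m}. i j < k) \<and> (m = 0 \<or> i m \<noteq> 0) \<and>
     w = nf_word (r + int m) \<alpha> m i s)"
proof -
  interpret group "BS k" by (rule group_BS)
  have a_pow: "a_pow k (e * ((\<Sum>j=1..m. of_nat (i j) / of_nat k ^ j) + of_nat s)) \<in> carrier (BS k)"
    if "e = 1 \<or> e = - 1" for e :: rat and m s :: nat and i :: "nat \<Rightarrow> nat"
  proof -
    have "of_nat (i j) / of_nat k ^ j = (of_nat (i j * k ^ (m - j)) / of_nat k ^ m :: rat)" if "j \<in> {1..m}" for j
    proof -
      have "(of_nat k :: rat) ^ m = of_nat k ^ (m - j) * of_nat k ^ j" using that by (simp flip: power_add)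
      then show ?thesis using k by simp
    qed
    then have "(\<Sum>j=1..m. of_nat (i j) / of_nat k ^ j) + of_nat s =
        (of_nat ((\<Sum>j=1..m. i j * k ^ (m - j)) + s * k ^ m) / of_nat k ^ m :: rat)"
      using k by (simp add: sum_divide_distrib add_divide_distrib)
    then have "e * ((\<Sum>j=1..m. of_nat (i j) / of_nat k ^ j) + of_nat s) =
        of_int ((if e = 1 then 1 else - 1) * int ((\<Sum>j=1..m. i j * k ^ (m - j)) + s * k ^ m)) / of_nat k ^ m"
      using that by auto
    then show ?thesis by (simp only: a_pow_eq[OF k]) simp
  qed
  show ?thesis (is "_ \<longleftrightarrow> ?R")
  proof
    assume "w \<in> NF k"
    then show ?R unfolding NF_def is_nf_def by blast
  next
    assume ?R
    then obtain r \<alpha> m s i where *: "\<alpha> \<in> {gen_a, gen_A}" "\<forall>j\<in>{1..m}. i j < k" "m = 0 \<or> i m \<noteq> 0"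
      "w = nf_word (r + int m) \<alpha> m i s" by blast
    let ?u = "(\<Sum>j=1..m. of_nat (i j) / of_nat k ^ j) + of_nat s :: rat"
    let ?g = "elt_b k [^]\<^bsub>BS k\<^esub> r \<otimes>\<^bsub>BS k\<^esub> a_pow k (if \<alpha> = gen_a then ?u else - ?u)"
    have "?g \<in> carrier (BS k)" using a_pow[of 1 i m s] a_pow[of "- 1" i m s] by simp
    moreover have "is_nf k ?g w" using * unfolding is_nf_def by blast
    ultimately show "w \<in> NF k" unfolding NF_def by blast
  qed
qed

text \<open>The case \<open>p < c\<close> is m > 0 in the normal form, with \<open>d p\<close> as
  the digit i_m.\<close>

definition tape_ok :: "nat \<Rightarrow> nat \<Rightarrow> nat \<Rightarrow> (nat \<Rightarrow> nat) \<Rightarrow> nat \<Rightarrow> bool" where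
  "tape_ok k p c d n \<longleftrightarrow> p \<le> c \<and> c < n \<and> (\<forall>j<n. d j < k) \<and> (\<forall>j<p. d j = 0) \<and> (p < c \<longrightarrow> d p \<noteq> 0)"

lemma rev_upt_eq_map_diff: "m \<le> c \<Longrightarrow> rev [1..<Suc m] = map (\<lambda>j. c - j) [c - m..<c]"
  by (rule nth_equalityI) (auto simp: rev_nth simp del: upt_Suc)

text \<open>The l-th digit behind the radix point sits at position c - l, whence m = c - p.\<close>

lemma tape_word_eq_nf_word:
  assumes "p \<le> c" "c < n" "r < n"
  shows "tape_word k \<alpha> p c r d n =
    nf_word (int r - int p) \<alpha> (c - p) (\<lambda>l. d (c - l)) (\<Sum>j=c..<n. d j * k ^ (j - c))"
proof -
  have "map (\<lambda>j. replicate (d (c - j)) \<alpha> @ [gen_B]) (rev [1..<Suc (c - p)]) =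
    map (\<lambda>j. replicate (d j) \<alpha> @ [gen_B]) [p..<c]"
    using assms(1) unfolding rev_upt_eq_map_diff[OF diff_le_self] by simp
  moreover have "min r n = r" "min p n = p" "min c n = c" using assms by auto
  ultimately show ?thesis
    unfolding tape_word_closed_form[OF assms(1)] nf_word_def by (simp only:)
qed

text \<open>Fractional and integer digits combine to one base k numeral over k^c; the zeros below
  \<open>p\<close> let its sum start at position 0.\<close>

lemma tape_word_sound:
  assumes k: "k \<ge> 1" and \<alpha>: "\<alpha> \<in> {gen_a, gen_A}" and ok: "tape_ok k p c d n" and r: "r < n"
  shows "tape_word k \<alpha> p c r d n \<in> NF k"
    and "val k (tape_word k \<alpha> p c r d n) = (int r - int c,
      (if \<alpha> = gen_a then 1 else - 1) * of_nat (\<Sum>j<n. d j * k ^ j) / of_nat k ^ c)"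
proof -
  let ?s = "\<Sum>j=c..<n. d j * k ^ (j - c)"
  have k0: "(of_nat k :: rat) \<noteq> 0" using k by simp
  have pc: "p \<le> c" "c < n" using ok by (auto simp: tape_ok_def)
  note eq = tape_word_eq_nf_word[OF pc r, of k \<alpha> d]
  have "int r - int p = (int r - int c) + int (c - p)" using pc by simp
  then have eq': "tape_word k \<alpha> p c r d n = nf_word ((int r - int c) + int (c - p)) \<alpha> (c - p) (\<lambda>l. d (c - l)) ?s"
    unfolding eq by (rule arg_cong)
  show "tape_word k \<alpha> p c r d n \<in> NF k"
    unfolding NF_iff[OF k] using \<alpha> eq' ok pc
    by (intro exI[of _ "int r - int c"] exI[of _ \<alpha>] exI[of _ "c - p"] exI[of _ ?s] exI[of _ "\<lambda>l. d (c - l)"])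
      (auto simp: tape_ok_def)
  have "(\<Sum>l=1..c - p. of_nat (d (c - l)) / of_nat k ^ l :: rat) = (\<Sum>j=p..<c. of_nat (d j) / of_nat k ^ (c - j))"
    by (rule sum.reindex_bij_witness[of _ "\<lambda>j. c - j" "\<lambda>l. c - l"]) auto
  also have "\<dots> = (\<Sum>j=p..<c. of_nat (d j) * of_nat k ^ j) / of_nat k ^ c"
    unfolding sum_divide_distrib using k0 by (intro sum.cong) (auto simp: power_diff)
  also have "(\<Sum>j=p..<c. of_nat (d j) * of_nat k ^ j :: rat) = (\<Sum>j<c. of_nat (d j) * of_nat k ^ j)"
    using ok by (intro sum.mono_neutral_left) (auto simp: tape_ok_def not_le)
  finally have 1: "(\<Sum>l=1..c - p. of_nat (d (c - l)) / of_nat k ^ l :: rat) =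
    (\<Sum>j<c. of_nat (d j) * of_nat k ^ j) / of_nat k ^ c" .
  have 2: "(of_nat ?s :: rat) = (\<Sum>j=c..<n. of_nat (d j) * of_nat k ^ j) / of_nat k ^ c"
    unfolding sum_divide_distrib of_nat_sum of_nat_mult of_nat_power using k0 by (intro sum.cong) (auto simp: power_diff)
  have "{..<n} = {..<c} \<union> {c..<n}" using pc by auto
  then have 3: "(\<Sum>j<n. of_nat (d j) * of_nat k ^ j :: rat) =
    (\<Sum>j<c. of_nat (d j) * of_nat k ^ j) + (\<Sum>j=c..<n. of_nat (d j) * of_nat k ^ j)"
    by (simp add: sum.union_disjoint ivl_disj_int)
  show "val k (tape_word k \<alpha> p c r d n) = (int r - int c,
      (if \<alpha> = gen_a then 1 else - 1) * of_nat (\<Sum>j<n. d j * k ^ j) / of_nat k ^ c)"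
    unfolding eq val_nf_word[OF k \<alpha>] 1 2 add_divide_distrib[symmetric] 3[symmetric]
    using pc by (simp add: of_nat_diff)
qed

lemma sum_digits_eq_mod: "(\<Sum>j<n. (s div k ^ j mod k) * k ^ j) = s mod (k ^ n :: nat)"
proof (induction n)
  case (Suc n)
  have "s mod (k ^ n * k) = k ^ n * (s div k ^ n mod k) + s mod k ^ n" by (rule mod_mult2_eq)
  with Suc show ?case by (simp add: mult.commute)
qed simp

text \<open>The radix point and the length stay free, apart from lower bounds, because three words
  must later be aligned on tapes of one length.\<close>

lemma tape_word_complete:
  assumes k: "k \<ge> 2" and w: "w \<in> NF k"
  shows "\<exists>\<alpha>\<in>{gen_a, gen_A}. \<exists>m. \<forall>c r. m \<le> c \<and> int r = fst (val k w) + int c \<longrightarrow>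
    (\<exists>n0. \<forall>n\<ge>n0. \<exists>p d. tape_ok k p c d n \<and> r < n \<and> w = tape_word k \<alpha> p c r d n)"
proof -
  obtain r0 \<alpha> m s i where \<alpha>: "\<alpha> \<in> {gen_a, gen_A}" and i: "\<forall>j\<in>{1..m}. i j < k" "m = 0 \<or> i m \<noteq> 0"
    and w: "w = nf_word (r0 + int m) \<alpha> m i s"
    using w NF_iff[of k w] k by (meson le_trans one_le_numeral)
  have fst: "fst (val k w) = r0" using k \<alpha> by (simp add: w val_nf_word del: insert_iff)
  show ?thesis
  proof (rule bexI[OF _ \<alpha>], rule exI[of _ m], intro allI impI)
    fix c r assume cr: "m \<le> c \<and> int r = fst (val k w) + int c"
    show "\<exists>n0. \<forall>n\<ge>n0. \<exists>p d. tape_ok k p c d n \<and> r < n \<and> w = tape_word k \<alpha> p c r d n"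
    \<comment> \<open>The length exceeds both marks and gives s < n - c < k^(n - c), so all base k
      digits of \<open>s\<close> fit.\<close>
    proof (rule exI[of _ "c + r + s + 1"], intro allI impI)
      fix n assume n: "c + r + s + 1 \<le> n"
      \<comment> \<open>Zero padding, then the fractional digits, then the base k digits of
        \<open>s\<close>.\<close>
      define d where "d j = (if j < c - m then 0 else if j < c then i (c - j) else s div k ^ (j - c) mod k)" for j
      have ok: "tape_ok k (c - m) c d n"
        unfolding tape_ok_def
      proof (intro conjI allI impI)
        show "d j < k" for j
        proof (cases "c - m \<le> j \<and> j < c")
          case True
          then have "c - j \<in> {1..m}" by auto
          then show ?thesis using i(1) True by (simp add: d_def)
        qed (use k in \<open>auto simp: d_def\<close>)
        show "d (c - m) \<noteq> 0" if "c - m < c"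
          using that cr i(2) by (auto simp: d_def)
      qed (use cr n in \<open>auto simp: d_def\<close>)
      have "(\<Sum>j=c..<n. d j * k ^ (j - c)) = (\<Sum>j<n - c. (s div k ^ j mod k) * k ^ j)"
        using n by (intro sum.reindex_bij_witness[of _ "\<lambda>j. j + c" "\<lambda>j. j - c"]) (auto simp: d_def)
      also have "\<dots> = s mod k ^ (n - c)" by (rule sum_digits_eq_mod)
      also have "\<dots> = s"
      proof (rule mod_less)
        have "s < n - c" using n by simp
        also have "\<dots> < k ^ (n - c)" using k by (intro less_exp[THEN order.strict_trans2] power_mono) auto
        finally show "s < k ^ (n - c)" .
      qed
      finally have s: "(\<Sum>j=c..<n. d j * k ^ (j - c)) = s" .
      have "tape_word k \<alpha> (c - m) c r d n = nf_word (int r - int (c - m)) \<alpha> m (\<lambda>l. d (c - l)) s"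
        using tape_word_eq_nf_word[of "c - m" c n r k \<alpha> d] cr n s by simp
      also have "int r - int (c - m) = r0 + int m" using cr fst by simp
      also have "nf_word (r0 + int m) \<alpha> m (\<lambda>l. d (c - l)) s = w"
      proof -
        have "d (c - l) = i l" if "l \<in> {1..m}" for l
        proof -
          have "\<not> c - l < c - m" "c - l < c" "c - (c - l) = l" using that cr by auto
          then show ?thesis by (simp add: d_def)
        qed
        then have "map (\<lambda>l. replicate (d (c - l)) \<alpha> @ [gen_B]) (rev [1..<Suc m]) =
          map (\<lambda>l. replicate (i l) \<alpha> @ [gen_B]) (rev [1..<Suc m])"
          by - (rule map_cong[OF refl], simp add: less_Suc_eq_le del: upt_Suc)
        then show ?thesis unfolding w nf_word_def by (simp only:)
      qed
      finally show "\<exists>p d. tape_ok k p c d n \<and> r < n \<and> w = tape_word k \<alpha> p c r d n"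
        using ok n by (intro exI[of _ "c - m"] exI[of _ d]) auto
    qed
  qed
qed

section \<open>The automaton for multiplication\<close>

text \<open>
  Tapes \<open>0\<close>, \<open>1\<close>, \<open>2\<close> carry the digits of \<open>x\<close>, \<open>y\<close>, \<open>z\<close>, aligned so that \<open>xy = z\<close> becomes a digitwise
  signed addition. A set of marks records what the reading head has passed: mark \<open>i < 3\<close> is the
  lowest digit of tape \<open>i\<close>, mark \<open>3\<close> the radix point of \<open>x\<close>, mark \<open>4\<close> that of \<open>y\<close> and of \<open>z\<close>. The marks
  \<open>3\<close> and \<open>4\<close> are \<open>r\<^sub>2\<close> apart, where \<open>y = b\<^bsup>r\<^sub>2\<^esup> a\<^bsup>q\<^esup>\<close>, and mark \<open>5\<close> lies \<open>r\<^sub>1 + r\<^sub>2\<close> beyond mark \<open>4\<close>; hence the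
  exponent of the initial power of \<open>b\<close> is, on each tape, the signed distance from its lowest digit
  to mark \<open>3\<close> or \<open>5\<close>.
\<close>

definition radix_mark :: "nat \<Rightarrow> nat" where
  "radix_mark i = (if i = 0 then 3 else 4)"

definition b_mark :: "nat \<Rightarrow> nat" where
  "b_mark i = (if i = 1 then 3 else 5)"

definition alpha :: "nat set \<Rightarrow> nat \<Rightarrow> gen" where
  "alpha N i = (if i \<in> N then gen_A else gen_a)"

text \<open>\<open>N\<close> holds the tapes with \<alpha> = A. The second factor moves z to the
  other side, so that the signed sum has to vanish.\<close>

definition tape_sign :: "nat set \<Rightarrow> nat \<Rightarrow> int" where
  "tape_sign N i = (if i \<in> N then - 1 else 1) * (if i = 2 then - 1 else 1)"

text \<open>Register \<open>i < 3\<close> holds the word of tape \<open>i\<close>, register \<open>i + 3\<close> the power of \<open>\<alpha>\<close> that a digit is worth.\<close>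

definition update :: "nat \<Rightarrow> nat set \<Rightarrow> nat set \<Rightarrow> (nat \<Rightarrow> nat) \<Rightarrow> nat \<Rightarrow> (letter + nat) list" where
  "update k N M d x =
    (if x < 3 then
       (if x \<in> M \<and> b_mark x \<notin> M then [Inl (Gen gen_b)]
        else if b_mark x \<in> M \<and> x \<notin> M then [Inl (Gen gen_B)] else []) @
       [Inr x] @
       (if radix_mark x \<in> M then replicate (d x) (Inr (x + 3))
        else if x \<in> M then replicate (d x) (Inl (Gen (alpha N x))) @ [Inl (Gen gen_B)] else [])
     else if radix_mark (x - 3) \<in> M then replicate k (Inr x) else [Inr x])"

text \<open>The trace of \<open>tape_ok\<close> at one position, with \<open>M\<close> and
  \<open>M'\<close> the marks passed before and after it; a mark in M' - M sits exactly
  there.\<close>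

definition digits_ok :: "nat \<Rightarrow> nat set \<Rightarrow> nat set \<Rightarrow> (nat \<Rightarrow> nat) \<Rightarrow> bool" where
  "digits_ok k M M' d \<longleftrightarrow> (\<forall>i<3. d i < k \<and> (radix_mark i \<in> M' \<longrightarrow> i \<in> M') \<and> (i \<notin> M' \<longrightarrow> d i = 0) \<and>
     (i \<in> M' \<and> i \<notin> M \<and> radix_mark i \<notin> M' \<longrightarrow> d i \<noteq> 0))"

text \<open>One column of an addition with carry \<open>c\<close> in and \<open>c'\<close> out.
  Marks and digits are guessed, the signs \<open>N\<close> stay fixed. Bounded carries and zero
  digits outside the three tapes keep the relation finite.\<close>

definition transitions ::
  "nat \<Rightarrow> ((nat set \<times> int \<times> nat set) \<times> (nat \<Rightarrow> (letter + nat) list) \<times> (nat set \<times> int \<times> nat set)) set" where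
  "transitions k = {((M, c, N), update k N M' d, (M', c', N)) | M c N M' d c'.
     M \<subseteq> M' \<and> M' \<subseteq> {..<6} \<and> N \<subseteq> {..<3} \<and> c \<in> {-3..3} \<and> c' \<in> {-3..3} \<and>
     (\<forall>i\<ge>3. d i = 0) \<and> digits_ok k M M' d \<and> c + (\<Sum>i<3. tape_sign N i * int (d i)) = int k * c'}"

definition initial :: "((nat set \<times> int \<times> nat set) \<times> (nat \<Rightarrow> letter list)) set" where
  "initial = (\<lambda>N. (({}, 0, N), \<lambda>x. if x < 3 then [] else [Gen (alpha N (x - 3))])) ` Pow {..<3}"

lemma finite_transitions: "finite (transitions k)"
proof -
  define D where "D = {d. \<forall>i::nat. (i \<in> {..<3} \<longrightarrow> d i \<in> {..<k}) \<and> (i \<notin> {..<3} \<longrightarrow> d i = 0)}"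
  have "finite D" unfolding D_def by (rule finite_set_of_finite_funs) simp_all
  then have fin: "finite (Pow {..<6::nat} \<times> {-3..3::int} \<times> Pow {..<3::nat} \<times> Pow {..<6::nat} \<times> D \<times> {-3..3::int})"
    by simp
  show ?thesis
  proof (rule finite_subset[OF _ finite_imageI[OF fin]])
    show "transitions k \<subseteq> (\<lambda>(M, c, N, M', d, c'). ((M, c, N), update k N M' d, (M', c', N))) `
      (Pow {..<6} \<times> {-3..3} \<times> Pow {..<3} \<times> Pow {..<6} \<times> D \<times> {-3..3})"
    proof
      fix t assume "t \<in> transitions k"
      then obtain M c N M' d c' where t: "t = ((M, c, N), update k N M' d, (M', c', N))"
        "M \<subseteq> M'" "M' \<subseteq> {..<6}" "N \<subseteq> {..<3}" "c \<in> {-3..3}" "c' \<in> {-3..3}" "\<forall>i\<ge>3. d i = 0" "digits_ok k M M' d"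
        unfolding transitions_def by blast
      then have "d \<in> D" by (auto simp: D_def digits_ok_def not_less)
      with t have "(M, c, N, M', d, c') \<in> Pow {..<6} \<times> {-3..3} \<times> Pow {..<3} \<times> Pow {..<6} \<times> D \<times> {-3..3}" by auto
      then show "t \<in> (\<lambda>(M, c, N, M', d, c'). ((M, c, N), update k N M' d, (M', c', N))) `
        (Pow {..<6} \<times> {-3..3} \<times> Pow {..<3} \<times> Pow {..<6} \<times> D \<times> {-3..3})"
        unfolding t(1) by (rule rev_image_eqI) simp
    qed
  qed
qed

lemma update_in_lists:
  "n < 6 \<Longrightarrow> update k N M d n \<in> lists (range Inl \<union> Inr ` {..<6})"
  by (auto simp: update_def)

section \<open>The invariant of a run, and soundness\<close>

definition passed :: "(nat \<Rightarrow> nat) \<Rightarrow> nat \<Rightarrow> nat set" where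
  "passed \<mu> n = {m. m < 6 \<and> \<mu> m < n}"

text \<open>\<open>\<mu>\<close> places the marks. Position \<open>j\<close> is processed with
  \<open>passed \<mu> (Suc j)\<close>, so a mark takes effect at its own position.\<close>

definition tapes_ok :: "nat \<Rightarrow> (nat \<Rightarrow> nat) \<Rightarrow> (nat \<Rightarrow> nat \<Rightarrow> nat) \<Rightarrow> nat \<Rightarrow> bool" where
  "tapes_ok k \<mu> d n \<longleftrightarrow> (\<forall>j<n. digits_ok k (passed \<mu> j) (passed \<mu> (Suc j)) (\<lambda>i. d i j))"

definition wsum :: "nat \<Rightarrow> nat set \<Rightarrow> (nat \<Rightarrow> nat \<Rightarrow> nat) \<Rightarrow> nat \<Rightarrow> int" where
  "wsum k N d n = (\<Sum>i<3. tape_sign N i * int (\<Sum>j<n. d i j * k ^ j))"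

text \<open>Truncated subtraction keeps a unit register at one letter up to the radix mark; from
  there on its length is the weight of the next digit.\<close>

definition regs :: "nat \<Rightarrow> nat set \<Rightarrow> (nat \<Rightarrow> nat) \<Rightarrow> (nat \<Rightarrow> nat \<Rightarrow> nat) \<Rightarrow> nat \<Rightarrow> nat \<Rightarrow> letter list" where
  "regs k N \<mu> d n x =
    (if x < 3 then map Gen (tape_word k (alpha N x) (\<mu> x) (\<mu> (radix_mark x)) (\<mu> (b_mark x)) (d x) n)
     else replicate (k ^ (n - \<mu> (radix_mark (x - 3)))) (Gen (alpha N (x - 3))))"

lemma mark_less [simp]: "radix_mark i < 6" "b_mark i < 6"
  by (simp_all add: radix_mark_def b_mark_def)

lemma concat_replicate_replicate: "concat (replicate m (replicate n x)) = replicate (m * n) x"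
  by (induction m) (simp_all add: replicate_add)

text \<open>A digit uses the unit register before that is multiplied by k, so the digit at the radix
  mark has weight k^0.\<close>

lemma regs_Suc:
  "(\<lambda>x. reg_eval (regs k N \<mu> d n) (update k N (passed \<mu> (Suc n)) (\<lambda>i. d i n) x)) = regs k N \<mu> d (Suc n)"
proof
  fix x
  have flag: "m \<in> passed \<mu> (Suc n) \<longleftrightarrow> \<mu> m \<le> n" if "m < 6" for m
    using that by (auto simp: passed_def)
  show "reg_eval (regs k N \<mu> d n) (update k N (passed \<mu> (Suc n)) (\<lambda>i. d i n) x) = regs k N \<mu> d (Suc n) x"
  proof (cases "x < 3")
    case True
    then have "x < 6" by simp
    with True show ?thesis
      by (simp add: update_def flag regs_def concat_replicate_replicate not_le)
  next
    case False
    then show ?thesis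
      by (simp add: update_def flag regs_def concat_replicate_replicate Suc_diff_le not_le)
  qed
qed

lemma regs_cong:
  assumes "\<And>m. m < 6 \<Longrightarrow> \<mu> m = \<mu>' m \<or> n \<le> \<mu> m \<and> n \<le> \<mu>' m" "\<And>i j. j < n \<Longrightarrow> d i j = d' i j"
  shows "regs k N \<mu> d n = regs k N \<mu>' d' n"
proof
  fix x
  have "n - \<mu> m = n - \<mu>' m" if "m < 6" for m
    using assms(1)[OF that] by auto
  moreover have "tape_word k \<alpha> (\<mu> x) (\<mu> (radix_mark x)) (\<mu> (b_mark x)) (d x) n =
    tape_word k \<alpha> (\<mu>' x) (\<mu>' (radix_mark x)) (\<mu>' (b_mark x)) (d' x) n" if "x < 3" for \<alpha>
    using that by (intro tape_word_cong assms) simp_all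
  ultimately show "regs k N \<mu> d n x = regs k N \<mu>' d' n x"
    by (simp add: regs_def)
qed

lemma wsum_Suc: "wsum k N d (Suc n) = wsum k N d n + (\<Sum>i<3. tape_sign N i * int (d i n)) * int k ^ n"
  unfolding wsum_def sum_distrib_right by (simp add: sum.distrib[symmetric] algebra_simps)

text \<open>A state records only which marks were passed, so positions and digits are rebuilt step
  by step; the carry is the signed sum divided by k^n.\<close>

lemma reach_sound:
  assumes "reach (transitions k) initial q \<rho>"
  shows "\<exists>M c N n \<mu> d. q = (M, c, N) \<and> N \<subseteq> {..<3} \<and> M = passed \<mu> n \<and> tapes_ok k \<mu> d n \<and>
    wsum k N d n = c * int k ^ n \<and> \<rho> = regs k N \<mu> d n"
  using assms
proof induction
  case (reach_init q \<rho>)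
  then obtain N where N: "N \<subseteq> {..<3}" "q = ({}, 0, N)" "\<rho> = (\<lambda>x. if x < 3 then [] else [Gen (alpha N (x - 3))])"
    by (auto simp: initial_def)
  then have "\<rho> = regs k N (\<lambda>_. 0) (\<lambda>_ _. 0) 0"
    by (auto simp: regs_def)
  moreover have "{} = passed (\<lambda>_. 0) 0" "tapes_ok k (\<lambda>_. 0) (\<lambda>_ _. 0) 0" "wsum k N (\<lambda>_ _. 0) 0 = 0 * int k ^ 0"
    by (auto simp: passed_def tapes_ok_def wsum_def)
  ultimately show ?case using N by blast
next
  case (reach_step q \<rho> \<sigma> q')
  then obtain M c N n \<mu> d where q: "q = (M, c, N)" "N \<subseteq> {..<3}" and M: "M = passed \<mu> n"
    and ok: "tapes_ok k \<mu> d n" and ws: "wsum k N d n = c * int k ^ n" and \<rho>: "\<rho> = regs k N \<mu> d n"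
    by blast
  from reach_step(2) q obtain M' e c' where
    \<sigma>: "\<sigma> = update k N M' e" "q' = (M', c', N)" "M \<subseteq> M'" "M' \<subseteq> {..<6}"
    "digits_ok k M M' e" "c + (\<Sum>i<3. tape_sign N i * int (e i)) = int k * c'"
    unfolding transitions_def by blast
  \<comment> \<open>Passed marks keep their positions, new ones get \<open>n\<close>, the others
    \<open>Suc n\<close>, just outside the part read so far.\<close>
  define \<mu>' where "\<mu>' m = (if m \<in> M then \<mu> m else if m \<in> M' then n else Suc n)" for m
  define d' where "d' i = (d i)(n := e i)" for i
  have p: "passed \<mu>' j = passed \<mu> j" if "j \<le> n" for j
    using that M by (auto simp: passed_def \<mu>'_def split: if_splits)
  have p': "passed \<mu>' (Suc n) = M'"
    using M \<sigma>(3,4) by (auto simp: passed_def \<mu>'_def split: if_splits)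
  have "tapes_ok k \<mu>' d' (Suc n)"
    using ok \<sigma>(5) unfolding tapes_ok_def
    by (auto simp: less_Suc_eq p p' d'_def M Suc_leI)
  moreover have "wsum k N d' (Suc n) = c' * int k ^ Suc n"
  proof -
    have "wsum k N d' n = wsum k N d n" by (simp add: wsum_def d'_def)
    then have "wsum k N d' (Suc n) = (c + (\<Sum>i<3. tape_sign N i * int (e i))) * int k ^ n"
      by (simp add: wsum_Suc ws d'_def algebra_simps)
    then show ?thesis by (simp add: \<sigma>(6))
  qed
  moreover have "regs k N \<mu> d n = regs k N \<mu>' d' n"
    using M by (intro regs_cong) (auto simp: \<mu>'_def d'_def passed_def)
  then have "(\<lambda>x. reg_eval \<rho> (\<sigma> x)) = regs k N \<mu>' d' (Suc n)"
    using regs_Suc[of k N \<mu>' d' n] by (simp add: \<rho> \<sigma>(1) p' d'_def)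
  ultimately show ?case using \<sigma>(2) q(2) p' by blast
qed

section \<open>Carry bounds and completeness of the runs\<close>

lemma sum_digits_less: "(\<And>j. j < n \<Longrightarrow> d j < k) \<Longrightarrow> (\<Sum>j<n. d j * k ^ j) < (k ^ n :: nat)"
proof (induction n)
  case (Suc n)
  then have "(\<Sum>j<n. d j * k ^ j) < k ^ n" by simp
  moreover have "Suc (d n) * k ^ n \<le> k * k ^ n" using Suc.prems by (intro mult_right_mono) (auto simp: Suc_leI)
  ultimately show ?case by simp
qed simp

text \<open>Three numbers below k^n; division by k^n yields the carry range of
  \<open>transitions\<close>.\<close>

lemma wsum_bound:
  assumes "tapes_ok k \<mu> d n"
  shows "\<bar>wsum k N d n\<bar> \<le> 3 * int k ^ n"
proof -
  have "\<bar>wsum k N d n\<bar> \<le> (\<Sum>i<3. \<bar>tape_sign N i * int (\<Sum>j<n. d i j * k ^ j)\<bar>)"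
    unfolding wsum_def by (rule sum_abs)
  also have "\<dots> \<le> (\<Sum>i<3::nat. int k ^ n)"
  proof (rule sum_mono)
    fix i :: nat assume "i \<in> {..<3}"
    then have "(\<Sum>j<n. d i j * k ^ j) < k ^ n"
      using assms by (intro sum_digits_less) (auto simp: tapes_ok_def digits_ok_def)
    then have "int (\<Sum>j<n. d i j * k ^ j) \<le> int k ^ n"
      by (metis less_imp_le of_nat_le_iff of_nat_power)
    moreover have "\<bar>tape_sign N i\<bar> = 1" by (simp add: tape_sign_def)
    ultimately show "\<bar>tape_sign N i * int (\<Sum>j<n. d i j * k ^ j)\<bar> \<le> int k ^ n"
      by (simp only: abs_mult mult_1 abs_of_nat)
  qed
  finally show ?thesis by simp
qed

text \<open>Later digits have weights divisible by k^n. If the total is 0, the partial sum is thus a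
  multiple of k^n and the carry an integer.\<close>

lemma wsum_diff_dvd: "n \<le> n' \<Longrightarrow> int k ^ n dvd wsum k N d n' - wsum k N d n"
proof (induction n' rule: dec_induct)
  case (step m)
  have "wsum k N d (Suc m) - wsum k N d n =
    (wsum k N d m - wsum k N d n) + (\<Sum>i<3. tape_sign N i * int (d i m)) * int k ^ m"
    by (simp add: wsum_Suc)
  moreover have "int k ^ n dvd int k ^ m" using step by (simp add: le_imp_power_dvd)
  ultimately show ?case using step by (simp only: dvd_add dvd_mult)
qed simp

text \<open>The carries are forced to be the partial sums over k^n: integral by
  \<open>wsum_diff_dvd\<close>, in range by \<open>wsum_bound\<close>.\<close>

lemma reach_complete:
  assumes k: "k \<ge> 1" and ok: "tapes_ok k \<mu> d l" and d: "\<And>i j. 3 \<le> i \<Longrightarrow> d i j = 0"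
    and N: "N \<subseteq> {..<3}" and ws: "wsum k N d l = 0" and n: "n \<le> l"
  shows "\<exists>c. wsum k N d n = c * int k ^ n \<and>
    reach (transitions k) initial (passed \<mu> n, c, N) (regs k N \<mu> d n)"
  using n
proof (induction n)
  case 0
  have "regs k N \<mu> d 0 = (\<lambda>x. if x < 3 then [] else [Gen (alpha N (x - 3))])"
    by (auto simp: regs_def)
  moreover have "passed \<mu> 0 = {}" by (simp add: passed_def)
  ultimately have "((passed \<mu> 0, 0, N), regs k N \<mu> d 0) \<in> initial"
    using N by (auto simp: initial_def)
  then show ?case by (intro exI[of _ 0]) (auto simp: wsum_def intro: reach_init)
next
  case (Suc n)
  have kpos: "int k ^ m > 0" for m using k by simp
  obtain c where c: "wsum k N d n = c * int k ^ n"
    and r: "reach (transitions k) initial (passed \<mu> n, c, N) (regs k N \<mu> d n)"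
    using Suc by auto
  have "int k ^ Suc n dvd wsum k N d (Suc n)"
    using wsum_diff_dvd[OF Suc.prems, of k N d] ws by simp
  then obtain c' where c': "wsum k N d (Suc n) = c' * int k ^ Suc n"
    by (metis dvdE mult.commute)
  have bound: "b \<in> {-3..3}" if "wsum k N d m = b * int k ^ m" "m \<le> l" for b m
  proof -
    have "tapes_ok k \<mu> d m" using ok that by (auto simp: tapes_ok_def)
    then have "\<bar>b\<bar> * int k ^ m \<le> 3 * int k ^ m" using wsum_bound[of k \<mu> d m N] that by (simp add: abs_mult)
    then have "\<bar>b\<bar> \<le> 3" using kpos[of m] by (simp only: mult_le_cancel_right_pos)
    then show ?thesis by auto
  qed
  have "(c + (\<Sum>i<3. tape_sign N i * int (d i n))) * int k ^ n = (int k * c') * int k ^ n"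
    using c c' wsum_Suc[of k N d n] by (simp add: distrib_right)
  then have "c + (\<Sum>i<3. tape_sign N i * int (d i n)) = int k * c'" using k by simp
  moreover have "digits_ok k (passed \<mu> n) (passed \<mu> (Suc n)) (\<lambda>i. d i n)"
    using ok Suc.prems by (auto simp: tapes_ok_def)
  moreover have "passed \<mu> n \<subseteq> passed \<mu> (Suc n)" "passed \<mu> (Suc n) \<subseteq> {..<6}" by (auto simp: passed_def)
  ultimately have "((passed \<mu> n, c, N), update k N (passed \<mu> (Suc n)) (\<lambda>i. d i n), (passed \<mu> (Suc n), c', N)) \<in> transitions k"
    unfolding transitions_def using bound[OF c] bound[OF c' Suc.prems] Suc.prems N d by fastforce
  from reach_step[OF r this] show ?case using c' unfolding regs_Suc by blast
qed

text \<open>With all marks inside the tape, the conditions checked position by position amount to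
  the global ones.\<close>

lemma tapes_ok_iff:
  assumes "\<And>m. m < 6 \<Longrightarrow> \<mu> m < n"
  shows "tapes_ok k \<mu> d n \<longleftrightarrow> (\<forall>i<3. tape_ok k (\<mu> i) (\<mu> (radix_mark i)) (d i) n)"
proof
  assume ok: "tapes_ok k \<mu> d n"
  show "\<forall>i<3. tape_ok k (\<mu> i) (\<mu> (radix_mark i)) (d i) n"
  proof (intro allI impI)
    fix i :: nat assume i: "i < 3"
    then have lt: "\<mu> i < n" "\<mu> (radix_mark i) < n" using assms by simp_all
    have *: "d i j < k" "\<mu> (radix_mark i) \<le> j \<Longrightarrow> \<mu> i \<le> j" "j < \<mu> i \<Longrightarrow> d i j = 0"
      "\<mu> i = j \<Longrightarrow> j < \<mu> (radix_mark i) \<Longrightarrow> d i j \<noteq> 0" if "j < n" for j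
      using ok that i by (auto simp: tapes_ok_def digits_ok_def passed_def less_Suc_eq_le not_le)
    show "tape_ok k (\<mu> i) (\<mu> (radix_mark i)) (d i) n"
      unfolding tape_ok_def using * lt by auto
  qed
next
  assume *: "\<forall>i<3. tape_ok k (\<mu> i) (\<mu> (radix_mark i)) (d i) n"
  show "tapes_ok k \<mu> d n"
    unfolding tapes_ok_def digits_ok_def
  proof (intro allI impI)
    fix j i :: nat assume j: "j < n" and i: "i < 3"
    have flag: "m \<in> passed \<mu> l \<longleftrightarrow> \<mu> m < l" if "m < 6" for m l
      using that by (simp add: passed_def)
    have i6: "i < 6" using i by simp
    have ok: "tape_ok k (\<mu> i) (\<mu> (radix_mark i)) (d i) n" using * i by blast
    have "d i j \<noteq> 0" if "\<mu> i \<le> j" "j \<le> \<mu> i" "j < \<mu> (radix_mark i)"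
      using ok that le_antisym[OF that(1,2)] by (auto simp: tape_ok_def)
    then show "d i j < k \<and>
       (radix_mark i \<in> passed \<mu> (Suc j) \<longrightarrow> i \<in> passed \<mu> (Suc j)) \<and>
       (i \<notin> passed \<mu> (Suc j) \<longrightarrow> d i j = 0) \<and>
       (i \<in> passed \<mu> (Suc j) \<and> i \<notin> passed \<mu> j \<and> radix_mark i \<notin> passed \<mu> (Suc j) \<longrightarrow> d i j \<noteq> 0)"
      using ok j unfolding flag[OF i6] flag[OF mark_less(1)] tape_ok_def
      by (auto simp: less_Suc_eq_le not_le)
  qed
qed

text \<open>Marks 3 and 4 differ by the b-exponent of y, so its power of k rescales the denominator
  of x to the one shared by y and z. The b-exponents telescope through marks 5, 3, 4, and only
  numerators remain to be compared.\<close>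

lemma mult_iff_wsum_eq_0:
  assumes k: "k \<ge> 1" and lt: "\<And>m. m < 6 \<Longrightarrow> \<mu> m < n"
    and ok: "\<And>i. i < 3 \<Longrightarrow> tape_ok k (\<mu> i) (\<mu> (radix_mark i)) (d i) n"
    and w: "\<And>i. w i = tape_word k (alpha N i) (\<mu> i) (\<mu> (radix_mark i)) (\<mu> (b_mark i)) (d i) n"
  shows "elt k (w 0 @ w 1) = elt k (w 2) \<longleftrightarrow> wsum k N d n = 0"
proof -
  define e :: "nat \<Rightarrow> int" where "e i = (if i \<in> N then - 1 else 1)" for i
  define s where "s i = e i * int (\<Sum>j<n. d i j * k ^ j)" for i
  have k0: "(of_nat k :: rat) \<noteq> 0" using k by simp
  have val: "val k (w i) = (int (\<mu> (b_mark i)) - int (\<mu> (radix_mark i)), of_int (s i) / of_nat k ^ \<mu> (radix_mark i))"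
    if "i < 3" for i
    unfolding w using tape_word_sound(2)[OF k _ ok[OF that] lt[of "b_mark i"], of "alpha N i"]
    by (auto simp: alpha_def e_def s_def)
  have pw: "(of_nat k :: rat) powi (int (\<mu> 3) - int (\<mu> 4)) = of_nat k ^ \<mu> 3 / of_nat k ^ \<mu> 4"
    using k0 by (simp add: power_int_diff)
  have "elt k (w 0 @ w 1) = elt k (w 2) \<longleftrightarrow> bs_mul k (val k (w 0)) (val k (w 1)) = val k (w 2)"
    by (simp add: elt_eq_iff_val_eq[OF k] val_append[OF k])
  also have "\<dots> \<longleftrightarrow> (of_int (s 0) + of_int (s 1)) / of_nat k ^ \<mu> 4 = (of_int (s 2) / of_nat k ^ \<mu> 4 :: rat)"
    using k0 by (simp add: val bs_mul_def radix_mark_def b_mark_def pw add_divide_distrib)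
  also have "\<dots> \<longleftrightarrow> of_int (s 0 + s 1) = (of_int (s 2) :: rat)"
    using k0 by simp
  also have "\<dots> \<longleftrightarrow> s 0 + s 1 = s 2" by (rule of_int_eq_iff)
  also have "\<dots> \<longleftrightarrow> wsum k N d n = 0"
  proof -
    have "(\<Sum>i<3. f i) = f 0 + f 1 + f 2" for f :: "nat \<Rightarrow> int"
      by (simp add: numeral_3_eq_3 numeral_2_eq_2)
    then have "wsum k N d n = s 0 + s 1 - s 2" by (simp add: wsum_def s_def e_def tape_sign_def)
    then show ?thesis by auto
  qed
  finally show ?thesis .
qed

section \<open>Accepting runs are exactly the products\<close>

lemma nat_less_3_cases: "i < (3::nat) \<Longrightarrow> i = 0 \<or> i = 1 \<or> i = 2"
  by linarith

lemma reach_iff: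
  assumes k: "k \<ge> 2"
  shows "(\<exists>q \<rho>. reach (transitions k) initial q \<rho> \<and> q \<in> {{..<6}} \<times> {0} \<times> UNIV \<and> \<rho> 0 = map Gen x \<and> \<rho> 1 = map Gen y \<and> \<rho> 2 = map Gen z)
    \<longleftrightarrow> x \<in> NF k \<and> y \<in> NF k \<and> z \<in> NF k \<and> elt k (x @ y) = elt k z"
    (is "?L \<longleftrightarrow> ?R")
proof
  have k1: "k \<ge> 1" using k by simp
  assume ?L
  \<comment> \<open>All six marks are passed and the carry is 0, so the whole signed sum
    vanishes.\<close>
  then obtain N n \<mu> d \<rho> where passed: "{..<6} = passed \<mu> n" and ok: "tapes_ok k \<mu> d n" and ws: "wsum k N d n = 0"
    and \<rho>: "\<rho> = regs k N \<mu> d n" "\<rho> 0 = map Gen x" "\<rho> 1 = map Gen y" "\<rho> 2 = map Gen z"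
    by (auto dest!: reach_sound)
  have lt: "\<mu> m < n" if "m < 6" for m
    using that passed by (auto simp: passed_def)
  have tok: "tape_ok k (\<mu> i) (\<mu> (radix_mark i)) (d i) n" if "i < 3" for i
    using ok that lt by (simp add: tapes_ok_iff)
  define w where "w i = tape_word k (alpha N i) (\<mu> i) (\<mu> (radix_mark i)) (\<mu> (b_mark i)) (d i) n" for i
  have "inj Gen" by (simp add: inj_def)
  then have xyz: "x = w 0" "y = w 1" "z = w 2"
    using \<rho> by (auto simp: regs_def w_def inj_map_eq_map)
  have "w i \<in> NF k" if "i < 3" for i
    unfolding w_def using lt by (intro tape_word_sound(1) k1 tok that) (auto simp: alpha_def)
  moreover have "elt k (w 0 @ w 1) = elt k (w 2)"
    using mult_iff_wsum_eq_0[OF k1 lt tok w_def] ws by simp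
  ultimately show ?R by (simp add: xyz)
next
  have k1: "k \<ge> 1" using k by simp
  assume R: ?R
  define w where "w i = (if i = 0 then x else if i = 1 then y else z)" for i :: nat
  have NF: "w i \<in> NF k" for i using R by (simp add: w_def)
  define r where "r i = fst (val k (w i))" for i
  have r2: "r 2 = r 0 + r 1"
    using R by (auto simp: r_def w_def elt_eq_iff_val_eq[OF k1] val_append[OF k1] bs_mul_def dest: arg_cong[where f = fst])
  have "\<exists>\<alpha> m. \<alpha> \<in> {gen_a, gen_A} \<and> (\<forall>c b. m \<le> c \<and> int b = r i + int c \<longrightarrow>
    (\<exists>n0. \<forall>n\<ge>n0. \<exists>p d. tape_ok k p c d n \<and> b < n \<and> w i = tape_word k \<alpha> p c b d n))" for i
    using tape_word_complete[OF k NF[of i]] unfolding r_def by blast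
  then obtain \<alpha> m where \<alpha>: "\<And>i. \<alpha> i \<in> {gen_a, gen_A}"
    and m: "\<And>i c b. m i \<le> c \<Longrightarrow> int b = r i + int c \<Longrightarrow>
      \<exists>n0. \<forall>n\<ge>n0. \<exists>p d. tape_ok k p c d n \<and> b < n \<and> w i = tape_word k (\<alpha> i) p c b d n"
    by metis
  \<comment> \<open>The radix position of y and z, large enough for all fractional digits and for
    marks 3 and 5 to stay nonnegative after their shifts.\<close>
  define K where "K = m 0 + m 1 + m 2 + nat \<bar>r 0\<bar> + nat \<bar>r 1\<bar>"
  define mark where "mark j = (if j = 3 then nat (int K + r 1) else if j = 4 then K else nat (int K + r 2))" for j :: nat
  have marks: "m i \<le> mark (radix_mark i)" "int (mark (b_mark i)) = r i + int (mark (radix_mark i))" if "i < 3" for i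
    using nat_less_3_cases[OF that] r2
    by (auto simp: mark_def radix_mark_def b_mark_def K_def)
  have "\<exists>n0. \<forall>n\<ge>n0. \<exists>p d. tape_ok k p (mark (radix_mark i)) d n \<and> mark (b_mark i) < n \<and>
      w i = tape_word k (\<alpha> i) p (mark (radix_mark i)) (mark (b_mark i)) d n" if "i < 3" for i
    using m[OF marks[OF that]] .
  then obtain n0 where n0: "\<And>i n. i < 3 \<Longrightarrow> n0 i \<le> n \<Longrightarrow> \<exists>p d. tape_ok k p (mark (radix_mark i)) d n \<and> mark (b_mark i) < n \<and>
      w i = tape_word k (\<alpha> i) p (mark (radix_mark i)) (mark (b_mark i)) d n"
    by metis
  \<comment> \<open>A length beyond all three thresholds serves the three tapes at once.\<close>
  define n where "n = n0 0 + n0 1 + n0 2"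
  have "n0 i \<le> n" if "i < 3" for i using nat_less_3_cases[OF that] by (auto simp: n_def)
  then have "\<exists>p d. i < 3 \<longrightarrow> tape_ok k p (mark (radix_mark i)) d n \<and> mark (b_mark i) < n \<and>
      w i = tape_word k (\<alpha> i) p (mark (radix_mark i)) (mark (b_mark i)) d n" for i
    using n0[of i n] by (cases "i < 3") simp_all
  then obtain p d0 where pd: "\<And>i. i < 3 \<Longrightarrow> tape_ok k (p i) (mark (radix_mark i)) (d0 i) n"
    "\<And>i. i < 3 \<Longrightarrow> mark (b_mark i) < n"
    "\<And>i. i < 3 \<Longrightarrow> w i = tape_word k (\<alpha> i) (p i) (mark (radix_mark i)) (mark (b_mark i)) (d0 i) n"
    by metis
  define \<mu> where "\<mu> j = (if j < 3 then p j else mark j)" for j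
  define d where "d i = (if i < 3 then d0 i else (\<lambda>_. 0))" for i
  define N where "N = {i. i < 3 \<and> \<alpha> i = gen_A}"
  have \<mu>: "\<mu> (radix_mark i) = mark (radix_mark i)" "\<mu> (b_mark i) = mark (b_mark i)" for i
    by (simp_all add: \<mu>_def radix_mark_def b_mark_def)
  have alpha: "alpha N i = \<alpha> i" if "i < 3" for i
    using \<alpha>[of i] that by (auto simp: alpha_def N_def)
  have tok: "tape_ok k (\<mu> i) (\<mu> (radix_mark i)) (d i) n" if "i < 3" for i
    using pd(1)[OF that] that unfolding \<mu> by (simp add: \<mu>_def d_def)
  have lt: "\<mu> j < n" if "j < 6" for j
  proof -
    have "j < 3 \<or> j = radix_mark 0 \<or> j = radix_mark 1 \<or> j = b_mark 0"
      using that by (auto simp: radix_mark_def b_mark_def)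
    then show ?thesis
      using tok[of j] tok[of 0] tok[of 1] pd(2)[of 0] by (auto simp: tape_ok_def \<mu>)
  qed
  define v where "v i = tape_word k (alpha N i) (\<mu> i) (\<mu> (radix_mark i)) (\<mu> (b_mark i)) (d i) n" for i
  have v: "v i = w i" if "i < 3" for i
    using pd(3)[OF that] that unfolding v_def \<mu> alpha[OF that] by (simp add: \<mu>_def d_def)
  have "elt k (v 0 @ v 1) = elt k (v 2)" using R by (simp add: v w_def)
  then have ws: "wsum k N d n = 0"
    using mult_iff_wsum_eq_0[OF k1 lt tok v_def] by simp
  have "tapes_ok k \<mu> d n" using tok lt by (simp add: tapes_ok_iff)
  from reach_complete[OF k1 this _ _ ws order_refl] ws k1 have
    "reach (transitions k) initial (passed \<mu> n, 0, N) (regs k N \<mu> d n)"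
    by (auto simp: d_def N_def)
  moreover have "passed \<mu> n = {..<6}" using lt by (auto simp: passed_def)
  moreover have "regs k N \<mu> d n i = map Gen (w i)" if "i < 3" for i
    using v[OF that] that by (simp add: regs_def v_def)
  then have "regs k N \<mu> d n 0 = map Gen x" "regs k N \<mu> d n 1 = map Gen y" "regs k N \<mu> d n 2 = map Gen z"
    by (simp_all add: w_def)
  ultimately show ?L by blast
qed

theorem theorem10:
  fixes k :: nat
  assumes "k \<ge> 2"
  shows "EDT0L {map Gen x @ [Hash] @ map Gen y @ [Hash] @ map Gen z | x y z.
           x \<in> NF k \<and> y \<in> NF k \<and> z \<in> NF k \<and> elt k (x @ y) = elt k z}"
proof -
  let ?F = "{{..<6}} \<times> {0} \<times> UNIV :: (nat set \<times> int \<times> nat set) set"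
  let ?v = "[Inr 0, Inl Hash, Inr 1, Inl Hash, Inr 2] :: (letter + nat) list"
  have "x \<in> {Hash, Gen gen_a, Gen gen_A, Gen gen_b, Gen gen_B}" for x
  proof (cases x)
    case (Gen g)
    then show ?thesis by (cases g) simp_all
  qed simp
  then have fin: "finite (UNIV :: letter set)"
    by (intro finite_subset[of UNIV "{Hash, Gen gen_a, Gen gen_A, Gen gen_b, Gen gen_B}"]) auto
  have "EDT0L {reg_eval \<rho> ?v | q \<rho>. reach (transitions k) initial q \<rho> \<and> q \<in> ?F}"
  proof (rule EDT0L_register_automaton[where N = 6])
    show "finite initial" by (simp add: initial_def)
    show "\<sigma> n \<in> lists (range Inl \<union> Inr ` {..<6})" if "(q, \<sigma>, q') \<in> transitions k" "n < 6" for q \<sigma> q' n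
    proof -
      from that(1) obtain N M d where "\<sigma> = update k N M d" unfolding transitions_def by blast
      then show ?thesis using update_in_lists[OF that(2)] by simp
    qed
  qed (use fin finite_transitions in auto)
  also have "{reg_eval \<rho> ?v | q \<rho>. reach (transitions k) initial q \<rho> \<and> q \<in> ?F} =
    {map Gen x @ [Hash] @ map Gen y @ [Hash] @ map Gen z | x y z.
      \<exists>q \<rho>. reach (transitions k) initial q \<rho> \<and> q \<in> ?F \<and> \<rho> 0 = map Gen x \<and> \<rho> 1 = map Gen y \<and> \<rho> 2 = map Gen z}"
    (is "?A = ?B")
  proof
    show "?A \<subseteq> ?B"
    proof
      fix u assume "u \<in> ?A"
      then obtain q \<rho> where q: "reach (transitions k) initial q \<rho>" "q \<in> ?F" "u = reg_eval \<rho> ?v" by blast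
      \<comment> \<open>Reachable registers 0, 1, 2 contain no \<open>Hash\<close>, so the output
        splits into three words over the generators.\<close>
      obtain N n \<mu> d where "\<rho> = regs k N \<mu> d n" using reach_sound[OF q(1)] by blast
      then have "\<exists>x. \<rho> i = map Gen x" if "i < 3" for i using that by (auto simp: regs_def)
      from this[of 0] this[of 1] this[of 2] obtain x y z where
        "\<rho> 0 = map Gen x" "\<rho> 1 = map Gen y" "\<rho> 2 = map Gen z" by auto
      moreover from this have "u = map Gen x @ [Hash] @ map Gen y @ [Hash] @ map Gen z" using q(3) by simp
      ultimately show "u \<in> ?B" using q(1,2) by blast
    qed
    show "?B \<subseteq> ?A"
    proof
      fix u assume "u \<in> ?B"
      then obtain x y z q \<rho> where q: "reach (transitions k) initial q \<rho>" "q \<in> ?F"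
        "\<rho> 0 = map Gen x" "\<rho> 1 = map Gen y" "\<rho> 2 = map Gen z"
        "u = map Gen x @ [Hash] @ map Gen y @ [Hash] @ map Gen z" by blast
      then have "u = reg_eval \<rho> ?v" by simp
      with q(1,2) show "u \<in> ?A" by blast
    qed
  qed
  finally show ?thesis unfolding reach_iff[OF assms] .
qed

end
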